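(* Let $f : \mathbb{R}^{N\times N} \to \mathbb{R}$ be differentiable with $\|\nabla f(X') - \nabla f(X'')\|_F \leq M_1 \|X' - X''\|_F$ for all $X', X'' \in \mathcal{O}(N)$, for some $M_1 > 0$. Let $\widetilde f : \mathbb{R}^{N\times N}\to\mathbb{R}$ be a random differentiable function such that $\mathbb{E}\,\nabla \widetilde f(X) = \nabla f(X)$ and $\mathbb{E}\,\|\nabla \widetilde f(X)\|_F^2 \leq M_2$ for all $X \in \mathcal{O}(N)$, for some $M_2>0$; at each iteration below an independent copy of $\widetilde f$ is drawn. Let $v^{(0,1)}, \dots, v^{(0,L)} \in \mathbb{R}^N$ be deterministic nonzero vectors and for $k > 0$, $1 \le l \le L$ define $$v^{(k,l)} = v^{(k-1,l)} - k^{-1/2}\, \nabla_{v^{(k-1,l)}} \widetilde f\big(H(v^{(k-1,1)}) \cdots H(v^{(k-1,L)})\big).$$ Then all $v^{(k,l)}$ are well-defined (nonzero), and for every $\epsilon > 0$, $$\min_{0 \le k' < K} \sum_{l=1}^L \mathbb{E}\,\Big\|\nabla_{v^{(k',l)}} f\big(H(v^{(k',1)}) \cdots H(v^{(k',L)})\big)\Big\|_2^2 = o\big(K^{-1/2+\epsilon}\big) \quad (K\to\infty).$$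
   Context: $\mathcal{O}(N) = \{Q \in \mathbb{R}^{N\times N} : Q^\top Q = I\}$; $\|\cdot\|_F$ is the Frobenius norm. For nonzero $v\in\mathbb{R}^N$, $H(v) = I - 2vv^\top/\|v\|_2^2$. The notation $\nabla_{v^{(l)}} g(H(v^{(1)})\cdots H(v^{(L)}))$ denotes the gradient with respect to $v^{(l)}\in\mathbb{R}^N$ of the composite function $(v^{(1)},\dots,v^{(L)}) \mapsto g(H(v^{(1)})\cdots H(v^{(L)}))$. *)

theory Defs
  imports "HOL-Analysis.Analysis" "HOL-Probability.Probability" "HOL-Library.Landau_Symbols"
begin

text \<open>Euclidean gradient of a differentiable real function on a Euclidean space
  (e.g. on real^'n^'n, where the inner product is the Frobenius inner product
  and norm is the Frobenius norm).\<close>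
definition grad :: "('a::real_inner \<Rightarrow> real) \<Rightarrow> 'a \<Rightarrow> 'a" where
  "grad g x = (SOME D. GDERIV g x :> D)"

definition householder :: "real^'n \<Rightarrow> real^'n^'n" where
  "householder v = mat 1 - (2 / (norm v)^2) *\<^sub>R (\<chi> i j. v$i * v$j)"

definition hprod :: "nat \<Rightarrow> (nat \<Rightarrow> real^'n) \<Rightarrow> real^'n^'n" where
  "hprod L V = foldr (\<lambda>l A. householder (V l) ** A) [1..<Suc L] (mat 1)"

definition pgrad :: "(real^'n^'n \<Rightarrow> real) \<Rightarrow> nat \<Rightarrow> (nat \<Rightarrow> real^'n) \<Rightarrow> nat \<Rightarrow> real^'n" where
  "pgrad g L V l = grad (\<lambda>w. g (hprod L (V(l := w)))) (V l)"

text \<open>SGD iterates: \<omega> k is the sample of the random function used at step k+1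
  (step size (k+1)^(-1/2)).\<close>
primrec sgd_iter :: "('w \<Rightarrow> real^'n^'n \<Rightarrow> real) \<Rightarrow> nat \<Rightarrow> (nat \<Rightarrow> real^'n)
     \<Rightarrow> (nat \<Rightarrow> 'w) \<Rightarrow> nat \<Rightarrow> (nat \<Rightarrow> real^'n)" where
  "sgd_iter ft L V0 \<omega> 0 = V0"
| "sgd_iter ft L V0 \<omega> (Suc k) =
     (\<lambda>l. sgd_iter ft L V0 \<omega> k l
          - (1 / sqrt (real (Suc k))) *\<^sub>R pgrad (ft (\<omega> k)) L (sgd_iter ft L V0 \<omega> k) l)"

end

theory Submission
  imports Defs "HOL-Real_Asymp.Real_Asymp"
begin

text \<open>
  The partial gradient of \<open>(v\<^sub>1, ..., v\<^sub>L) \<mapsto> g (H v\<^sub>1 \<cdots> H v\<^sub>L)\<close> with respect to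
  \<open>v\<^sub>l\<close> is orthogonal to \<open>v\<^sub>l\<close>, since \<open>H\<close> is invariant under rescaling of its argument.
  So an SGD step can only increase each \<open>\<parallel>v\<^sub>l\<parallel>\<close>: the iterates stay at distance at least
  \<open>c\<^sub>0 = min\<^sub>l \<parallel>V0 l\<parallel>\<close> from \<open>0\<close>, and their Householder products stay orthogonal.
  On this region the Householder product has first- and second-order terms bounded by the relative
  perturbations \<open>\<parallel>d\<^sub>l\<parallel> / \<parallel>v\<^sub>l\<parallel>\<close>, so the Lipschitz gradient of \<open>f\<close> gives a descent
  inequality \<open>f X\<^sub>k\<^sub>+\<^sub>1 \<le> f X\<^sub>k - s\<^sub>k \<Sum>\<^sub>l \<langle>\<nabla>\<^sub>l f, \<nabla>\<^sub>l f\<^sub>k\<rangle> + C s\<^sub>k\<^sup>2 \<parallel>\<nabla>f\<^sub>k\<parallel>\<^sup>2\<close>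
  for the sample \<open>f\<^sub>k\<close> drawn at step \<open>k\<close>. This sample is independent of \<open>X\<^sub>k\<close>, so by
  unbiasedness the middle term has expectation \<open>s\<^sub>k \<Sum>\<^sub>l E \<parallel>\<nabla>\<^sub>l f\<parallel>\<^sup>2\<close>. As \<open>f\<close> is bounded on
  the compact set of orthogonal matrices, telescoping with \<open>s\<^sub>k = 1 / \<surd>(k+1)\<close> bounds the minimum
  over \<open>k < K\<close> by \<open>(a + b ln K) / \<surd>K\<close>.
\<close>

section \<open>Matrix norms and outer products\<close>

lemma norm_matrix_mult_le:
  fixes A :: "real^'n^'m" and B :: "real^'p^'n"
  shows "norm (A ** B) \<le> norm A * norm B"
proof -
  have row: "norm ((A ** B)$i) \<le> norm (A$i) * norm B" for i
  proof -
    have "(A ** B)$i = (\<Sum>k\<in>UNIV. A$i$k *\<^sub>R B$k)"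
      by (simp add: matrix_matrix_mult_def vec_eq_iff sum_component)
    hence "norm ((A ** B)$i) \<le> (\<Sum>k\<in>UNIV. \<bar>A$i$k\<bar> * \<bar>norm (B$k)\<bar>)"
      using norm_sum[of "\<lambda>k. A$i$k *\<^sub>R B$k" UNIV] by simp
    also have "\<dots> \<le> L2_set (\<lambda>k. A$i$k) UNIV * L2_set (\<lambda>k. norm (B$k)) UNIV"
      by (rule L2_set_mult_ineq)
    also have "\<dots> = norm (A$i) * norm B"
      by (simp add: norm_vec_def L2_set_def)
    finally show ?thesis .
  qed
  have "norm (A ** B) = L2_set (\<lambda>i. norm ((A ** B)$i)) UNIV" by (simp add: norm_vec_def)
  also have "\<dots> \<le> L2_set (\<lambda>i. norm (A$i) * norm B) UNIV"
    by (rule L2_set_mono) (auto simp: row)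
  also have "\<dots> = norm A * norm B"
    by (simp add: norm_vec_def L2_set_left_distrib)
  finally show ?thesis .
qed

lemma bounded_bilinear_matrix_mult:
  "bounded_bilinear ((**) :: real^'n^'m \<Rightarrow> real^'p^'n \<Rightarrow> real^'p^'m)"
proof
  fix a a' :: "real^'n^'m" and b b' :: "real^'p^'n" and r :: real
  show "(a + a') ** b = a ** b + a' ** b"
    by (simp add: matrix_matrix_mult_def vec_eq_iff sum.distrib algebra_simps)
  show "a ** (b + b') = a ** b + a ** b'" by (rule matrix_add_ldistrib)
  show "(r *\<^sub>R a) ** b = r *\<^sub>R (a ** b)" by (simp add: scalar_matrix_assoc)
  show "a ** (r *\<^sub>R b) = r *\<^sub>R (a ** b)" by (simp add: matrix_scalar_ac scalar_matrix_assoc)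
  show "\<exists>K. \<forall>(a::real^'n^'m) (b::real^'p^'n). norm (a ** b) \<le> norm a * norm b * K"
    using norm_matrix_mult_le by (metis mult.right_neutral)
qed

lemma norm_matrix_sq_eq_trace: "(norm A)^2 = trace (A ** transpose (A :: real^'n^'m))"
proof -
  have "(norm A)^2 = A \<bullet> A" by (rule power2_norm_eq_inner)
  thus ?thesis by (simp add: inner_vec_def trace_def matrix_matrix_mult_def transpose_def)
qed

lemma norm_orthogonal_matrix_mult:
  fixes Q A :: "real^'n^'n"
  assumes "orthogonal_matrix Q"
  shows "norm (Q ** A) = norm A" and "norm (A ** Q) = norm A"
proof -
  have QQ: "transpose Q ** Q = mat 1" "Q ** transpose Q = mat 1"
    using assms by (simp_all add: orthogonal_matrix_def)
  have "trace ((Q ** A) ** transpose (Q ** A)) = trace ((transpose Q ** Q) ** (A ** transpose A))"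
    by (metis matrix_transpose_mul matrix_mul_assoc trace_mul_sym)
  hence "(norm (Q ** A))^2 = (norm A)^2" by (simp add: norm_matrix_sq_eq_trace QQ)
  thus "norm (Q ** A) = norm A" by simp
  have "trace ((A ** Q) ** transpose (A ** Q)) = trace (A ** (Q ** transpose Q) ** transpose A)"
    by (simp add: matrix_transpose_mul matrix_mul_assoc)
  hence "(norm (A ** Q))^2 = (norm A)^2" by (simp add: norm_matrix_sq_eq_trace QQ)
  thus "norm (A ** Q) = norm A" by simp
qed

lemma norm_orthogonal_matrix:
  "orthogonal_matrix (Q :: real^'n^'n) \<Longrightarrow> norm Q = sqrt (real CARD('n))"
proof -
  have "(norm (mat 1 :: real^'n^'n))^2 = real CARD('n)"
    by (simp add: norm_matrix_sq_eq_trace transpose_mat trace_I)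
  moreover assume "orthogonal_matrix Q"
  ultimately show ?thesis
    using norm_orthogonal_matrix_mult(1)[of Q "mat 1"] by (simp add: real_sqrt_unique)
qed

lemma compact_orthogonal_matrices: "compact {X :: real^'n^'n. orthogonal_matrix X}"
proof -
  have "bounded_linear (transpose :: real^'n^'n \<Rightarrow> real^'n^'n)"
    by (intro linear_conv_bounded_linear[THEN iffD1] linearI) (simp_all add: transpose_def vec_eq_iff)
  hence "continuous_on UNIV (\<lambda>X :: real^'n^'n. transpose X ** X)"
    by (intro bounded_bilinear.continuous_on[OF bounded_bilinear_matrix_mult] continuous_on_id
        linear_continuous_on)
  hence "closed {X :: real^'n^'n. transpose X ** X = mat 1}"
    by (intro closed_Collect_eq) simp_all
  moreover have "bounded {X :: real^'n^'n. orthogonal_matrix X}"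
    by (auto simp: bounded_iff norm_orthogonal_matrix)
  ultimately show ?thesis by (simp add: compact_eq_bounded_closed orthogonal_matrix)
qed

lemma bounded_on_orthogonal_matrices:
  fixes g :: "real^'n^'n \<Rightarrow> 'a::real_normed_vector"
  assumes "continuous_on {X. orthogonal_matrix X} g"
  obtains B where "\<And>X. orthogonal_matrix X \<Longrightarrow> norm (g X) \<le> B"
  using compact_imp_bounded[OF compact_continuous_image[OF assms compact_orthogonal_matrices]]
  by (auto simp: bounded_iff)

definition outer :: "real^'n \<Rightarrow> real^'m \<Rightarrow> real^'m^'n" where
  "outer u v = (\<chi> i j. u$i * v$j)"

lemma norm_outer: "norm (outer u v) = norm u * norm v"
proof -
  have "outer u v = (\<chi> i. u$i *\<^sub>R v)" by (simp add: outer_def vec_eq_iff)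
  hence "norm (outer u v) = L2_set (\<lambda>i. \<bar>u$i\<bar> * norm v) UNIV"
    using norm_vec_def[of "\<chi> i. u$i *\<^sub>R v"] by simp
  also have "\<dots> = L2_set (\<lambda>i. u$i) UNIV * norm v"
    by (simp add: L2_set_def power_mult_distrib sum_distrib_right[symmetric] real_sqrt_mult)
  also have "L2_set (\<lambda>i. u$i) UNIV = norm u" by (simp add: norm_vec_def L2_set_def)
  finally show ?thesis .
qed

lemma bounded_bilinear_outer: "bounded_bilinear (outer :: real^'n \<Rightarrow> real^'m \<Rightarrow> real^'m^'n)"
proof
  fix a a' :: "real^'n" and b b' :: "real^'m" and r :: real
  show "outer (a + a') b = outer a b + outer a' b" by (simp add: outer_def vec_eq_iff algebra_simps)
  show "outer a (b + b') = outer a b + outer a b'" by (simp add: outer_def vec_eq_iff algebra_simps)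
  show "outer (r *\<^sub>R a) b = r *\<^sub>R outer a b" by (simp add: outer_def vec_eq_iff)
  show "outer a (r *\<^sub>R b) = r *\<^sub>R outer a b" by (simp add: outer_def vec_eq_iff algebra_simps)
  show "\<exists>K. \<forall>a b. norm (outer a b) \<le> norm a * norm b * K"
    by (rule exI[of _ 1]) (simp add: norm_outer)
qed

lemma outer_mult_outer: "outer a b ** outer c d = (b \<bullet> c) *\<^sub>R outer a d"
  by (simp add: outer_def matrix_matrix_mult_def vec_eq_iff inner_vec_def sum_distrib_left
       sum_distrib_right algebra_simps)

section \<open>Householder reflections\<close>

lemma householder_eq_outer: "householder v = mat 1 - (2 / (norm v)^2) *\<^sub>R outer v v"
  by (simp add: householder_def outer_def)

lemma orthogonal_matrix_householder:
  assumes "v \<noteq> 0"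
  shows "orthogonal_matrix (householder v)"
proof -
  let ?c = "2 / (norm v)^2" and ?P = "outer v v"
  have "transpose (householder v) = householder v"
    by (simp add: householder_eq_outer outer_def mat_def vec_eq_iff transpose_def)
  moreover have "householder v ** householder v
      = mat 1 - ?c *\<^sub>R ?P - ?c *\<^sub>R ?P + (?c * ?c) *\<^sub>R (?P ** ?P)"
    unfolding householder_eq_outer
    by (simp add: bounded_bilinear.diff_left[OF bounded_bilinear_matrix_mult]
        bounded_bilinear.diff_right[OF bounded_bilinear_matrix_mult]
        scalar_matrix_assoc[symmetric] matrix_scalar_ac algebra_simps)
  moreover have "(?c * ?c) *\<^sub>R (?P ** ?P) = (2 * ?c) *\<^sub>R ?P"
    using assms by (simp add: outer_mult_outer power2_norm_eq_inner[symmetric] power2_eq_square)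
  moreover have "mat 1 - ?c *\<^sub>R ?P - ?c *\<^sub>R ?P + (2 * ?c) *\<^sub>R ?P = mat 1"
    by (simp only: mult_2 scaleR_add_left) simp
  ultimately show ?thesis
    by (simp add: orthogonal_matrix)
qed

definition dhouseholder :: "real^'n \<Rightarrow> real^'n \<Rightarrow> real^'n^'n" where
  "dhouseholder v d = (4 * (v \<bullet> d) / (norm v)^4) *\<^sub>R outer v v
     - (2 / (norm v)^2) *\<^sub>R (outer d v + outer v d)"

lemma has_derivative_householder:
  fixes v :: "real^'n"
  assumes "v \<noteq> 0"
  shows "(householder has_derivative dhouseholder v) (at v)"
proof -
  have vv: "v \<bullet> v \<noteq> 0" using assms by simp
  have eq: "householder = (\<lambda>w. mat 1 - (2 / (w \<bullet> w)) *\<^sub>R outer w w)"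
    by (simp add: fun_eq_iff householder_eq_outer power2_norm_eq_inner)
  have "((\<lambda>w. mat 1 - (2 / (w \<bullet> w)) *\<^sub>R outer w w) has_derivative
     (\<lambda>h. 0 - ((2 / (v \<bullet> v)) *\<^sub>R (outer v h + outer h v)
               + (- (2 * inverse (v \<bullet> v) * (h \<bullet> v + v \<bullet> h) * inverse (v \<bullet> v))) *\<^sub>R outer v v)))
     (at v)"
    using vv by (auto intro!: derivative_eq_intros bounded_bilinear.FDERIV[OF bounded_bilinear_outer]
        simp: divide_inverse)
  then show ?thesis
    unfolding eq
    by (rule has_derivative_eq_rhs)
      (use vv in \<open>simp add: dhouseholder_def fun_eq_iff power2_norm_eq_inner[symmetric]
        inner_commute power4_eq_xxxx field_simps\<close>)
qed

lemma dhouseholder_self: "dhouseholder v v = 0"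
  by (cases "v = 0")
    (auto simp: dhouseholder_def outer_def vec_eq_iff power2_norm_eq_inner[symmetric]
      power4_eq_xxxx field_simps)

lemma dhouseholder_zero: "dhouseholder v 0 = 0"
  by (simp add: dhouseholder_def outer_def vec_eq_iff)

text \<open>As \<open>householder (c *\<^sub>R v) = householder v\<close>, perturbation bounds only involve the
  relative size \<open>norm d / norm v\<close> of a perturbation \<open>d\<close> of \<open>v\<close>.\<close>

lemma norm_dhouseholder_le: "norm (dhouseholder v d) \<le> 8 * (norm d / norm v)"
proof (cases "v = 0")
  case True thus ?thesis by (simp add: dhouseholder_def outer_def)
next
  case False
  hence nv: "norm v > 0" by simp
  have "norm ((4 * (v \<bullet> d) / (norm v)^4) *\<^sub>R outer v v) = 4 * \<bar>v \<bullet> d\<bar> / (norm v)^2"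
    using nv by (simp add: norm_outer power4_eq_xxxx power2_eq_square abs_mult)
  also have "\<dots> \<le> 4 * (norm v * norm d) / (norm v)^2"
    by (intro divide_right_mono mult_left_mono Cauchy_Schwarz_ineq2) auto
  finally have t1: "norm ((4 * (v \<bullet> d) / (norm v)^4) *\<^sub>R outer v v) \<le> 4 * (norm d / norm v)"
    using nv by (simp add: power2_eq_square)
  have "norm (outer d v + outer v d) \<le> 2 * (norm v * norm d)"
    using norm_triangle_ineq[of "outer d v" "outer v d"] by (simp add: norm_outer mult.commute)
  hence "2 / (norm v)^2 * norm (outer d v + outer v d) \<le> 2 / (norm v)^2 * (2 * (norm v * norm d))"
    by (rule mult_left_mono) simp
  hence "norm ((2 / (norm v)^2) *\<^sub>R (outer d v + outer v d)) \<le> 2 / (norm v)^2 * (2 * (norm v * norm d))"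
    by simp
  hence t2: "norm ((2 / (norm v)^2) *\<^sub>R (outer d v + outer v d)) \<le> 4 * (norm d / norm v)"
    using nv by (simp add: power2_eq_square)
  show ?thesis
    using norm_triangle_ineq4[of "(4 * (v \<bullet> d) / (norm v)^4) *\<^sub>R outer v v"
        "(2 / (norm v)^2) *\<^sub>R (outer d v + outer v d)"] t1 t2
    unfolding dhouseholder_def by linarith
qed

lemma norm_householder_diff_le: "norm (householder w - householder v) \<le> 4"
proof -
  have proj: "norm ((2 / (norm u)^2) *\<^sub>R outer u u) \<le> 2" for u :: "real^'n"
    by (cases "u = 0") (auto simp: norm_outer power2_eq_square)
  have "norm (householder w - householder v)
      = norm ((2 / (norm v)^2) *\<^sub>R outer v v - (2 / (norm w)^2) *\<^sub>R outer w w)"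
    by (simp add: householder_eq_outer)
  thus ?thesis
    using norm_triangle_ineq4[of "(2 / (norm v)^2) *\<^sub>R outer v v" "(2 / (norm w)^2) *\<^sub>R outer w w"]
      proj[of v] proj[of w] by linarith
qed

lemma householder_remainder_eq:
  fixes v d :: "real^'n"
  assumes "v \<noteq> 0" and "v \<bullet> d = 0"
  shows "householder (v + d) - householder v - dhouseholder v d =
    (2 * (norm d)^2 / ((norm v)^2 * ((norm v)^2 + (norm d)^2))) *\<^sub>R (outer v v + outer d v + outer v d)
    - (2 / ((norm v)^2 + (norm d)^2)) *\<^sub>R outer d d"
proof -
  have pyth: "(norm (v + d))^2 = (norm v)^2 + (norm d)^2"
    using norm_add_Pythagorean[of v d] assms(2) by (simp add: orthogonal_def)
  have a: "(norm v)^2 > 0" using assms(1) by simp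
  have ab: "(norm v)^2 + (norm d)^2 > 0" using a by (simp add: add_pos_nonneg)
  have scalar: "(m - 2 / (a + b) * ((x + z) * (y + w))) - (m - 2 / a * (x * y)) - (0 - 2 / a * (z * y + x * w))
     = (2 * b / (a * (a + b))) * (x * y + z * y + x * w) - 2 / (a + b) * (z * w)"
    if "a > 0" "a + b > 0" for a b x y z w m :: real
  proof -
    have e: "2 / a - 2 / (a + b) = 2 * b / (a * (a + b))" using that by (simp add: field_simps)
    have "(m - 2 / (a + b) * ((x + z) * (y + w))) - (m - 2 / a * (x * y)) - (0 - 2 / a * (z * y + x * w))
      = (2 / a - 2 / (a + b)) * (x * y + z * y + x * w) - 2 / (a + b) * (z * w)"
      by (simp add: algebra_simps)
    thus ?thesis by (simp only: e)
  qed
  show ?thesis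
    unfolding householder_eq_outer dhouseholder_def pyth assms(2)
    using scalar[OF a ab] by (simp add: vec_eq_iff outer_def)
qed

lemma norm_householder_remainder_le:
  fixes v d :: "real^'n"
  assumes v0: "v \<noteq> 0" and orth: "v \<bullet> d = 0"
  shows "norm (householder (v + d) - householder v - dhouseholder v d) \<le> 6 * (norm d / norm v)^2"
proof -
  define a where "a = (norm v)^2"
  define b where "b = (norm d)^2"
  have a: "a > 0" using v0 by (simp add: a_def)
  have b: "b \<ge> 0" by (simp add: b_def)
  have ab: "a + b > 0" using a b by linarith
  have amgm: "2 * (norm v * norm d) \<le> a + b"
    unfolding a_def b_def using sum_squares_bound[of "norm v" "norm d"] by (simp add: power2_eq_square)
  have "norm (outer v v + outer d v + outer v d) \<le> a + 2 * (norm v * norm d)"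
    using norm_triangle_ineq[of "outer v v + outer d v" "outer v d"]
      norm_triangle_ineq[of "outer v v" "outer d v"]
    by (simp add: norm_outer a_def power2_eq_square mult.commute)
  hence "norm (outer v v + outer d v + outer v d) \<le> 2 * a + b" using amgm by linarith
  hence "norm ((2 * b / (a * (a + b))) *\<^sub>R (outer v v + outer d v + outer v d))
      \<le> (2 * b / (a * (a + b))) * (2 * a + b)"
    using a b by (simp only: norm_scaleR) (intro mult_mono; simp)
  also have "\<dots> = 2 * b / (a + b) + 2 * b / a" using a ab by (simp add: field_simps)
  also have "\<dots> \<le> 4 * b / a" using a b frac_le[of "2 * b" "2 * b" a "a + b"] by simp
  finally have t1: "norm ((2 * b / (a * (a + b))) *\<^sub>R (outer v v + outer d v + outer v d)) \<le> 4 * b / a" .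
  have "norm ((2 / (a + b)) *\<^sub>R outer d d) = 2 * b / (a + b)"
    using ab by (simp add: norm_outer b_def power2_eq_square)
  also have "\<dots> \<le> 2 * b / a" using a b by (intro divide_left_mono) auto
  finally have t2: "norm ((2 / (a + b)) *\<^sub>R outer d d) \<le> 2 * b / a" .
  have "norm (householder (v + d) - householder v - dhouseholder v d) \<le> 6 * b / a"
    unfolding householder_remainder_eq[OF v0 orth] a_def[symmetric] b_def[symmetric]
    using norm_triangle_ineq4[of "(2 * b / (a * (a + b))) *\<^sub>R (outer v v + outer d v + outer v d)"
        "(2 / (a + b)) *\<^sub>R outer d d"] t1 t2 by linarith
  thus ?thesis by (simp add: a_def b_def power_divide)
qed

lemma norm_householder_diff_le_ratio:
  fixes v d :: "real^'n"
  assumes "v \<noteq> 0" and "v \<bullet> d = 0"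
  shows "norm (householder (v + d) - householder v) \<le> 14 * (norm d / norm v)"
proof (cases "norm d / norm v \<le> 1")
  case True
  have "norm (householder (v + d) - householder v)
      \<le> norm (dhouseholder v d) + norm (householder (v + d) - householder v - dhouseholder v d)"
    using norm_triangle_ineq[of "dhouseholder v d" "householder (v + d) - householder v - dhouseholder v d"]
    by simp
  moreover have "(norm d / norm v)^2 \<le> norm d / norm v"
    using True mult_left_le[of "norm d / norm v" "norm d / norm v"] by (simp add: power2_eq_square)
  ultimately show ?thesis
    using norm_dhouseholder_le[of v d] norm_householder_remainder_le[OF assms] by linarith
next
  case False
  thus ?thesis using norm_householder_diff_le[of "v + d" v] by linarith
qed

section \<open>Products of Householder reflections\<close>

definition hprodl :: "nat list \<Rightarrow> (nat \<Rightarrow> real^'n) \<Rightarrow> real^'n^'n" where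
  "hprodl xs W = foldr (\<lambda>l A. householder (W l) ** A) xs (mat 1)"

lemma hprodl_Nil [simp]: "hprodl [] W = mat 1"
  and hprodl_Cons [simp]: "hprodl (x # xs) W = householder (W x) ** hprodl xs W"
  by (simp_all add: hprodl_def)

lemma hprod_eq_hprodl: "hprod L V = hprodl [1..<Suc L] V"
  by (simp add: hprod_def hprodl_def)

primrec hprodl_deriv :: "nat list \<Rightarrow> (nat \<Rightarrow> real^'n) \<Rightarrow> (nat \<Rightarrow> real^'n) \<Rightarrow> real^'n^'n" where
  "hprodl_deriv [] W D = 0"
| "hprodl_deriv (x # xs) W D =
     dhouseholder (W x) (D x) ** hprodl xs W + householder (W x) ** hprodl_deriv xs W D"

lemma orthogonal_matrix_hprodl:
  "(\<And>l. l \<in> set xs \<Longrightarrow> W l \<noteq> 0) \<Longrightarrow> orthogonal_matrix (hprodl xs W)"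
  by (induction xs) (auto simp: orthogonal_matrix_id orthogonal_matrix_mul orthogonal_matrix_householder)

lemma has_derivative_hprodl:
  fixes p :: "'a::real_normed_vector \<Rightarrow> nat \<Rightarrow> real^'n"
  assumes "\<And>l. l \<in> set xs \<Longrightarrow> p x l \<noteq> 0"
    and "\<And>l. l \<in> set xs \<Longrightarrow> ((\<lambda>y. p y l) has_derivative Dp l) (at x within S)"
  shows "((\<lambda>y. hprodl xs (p y)) has_derivative (\<lambda>h. hprodl_deriv xs (p x) (\<lambda>l. Dp l h))) (at x within S)"
  using assms
proof (induction xs)
  case (Cons a xs)
  have IH: "((\<lambda>y. hprodl xs (p y)) has_derivative (\<lambda>h. hprodl_deriv xs (p x) (\<lambda>l. Dp l h)))
      (at x within S)"
    using Cons by simp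
  have "((\<lambda>y. householder (p y a)) has_derivative (\<lambda>h. dhouseholder (p x a) (Dp a h))) (at x within S)"
    using Cons.prems by (intro has_derivative_compose[OF _ has_derivative_householder]) auto
  from bounded_bilinear.FDERIV[OF bounded_bilinear_matrix_mult this IH]
  show ?case by (simp add: add.commute)
qed simp

lemma hprodl_deriv_eq_0:
  "(\<And>l. l \<in> set xs \<Longrightarrow> D l = 0) \<Longrightarrow> hprodl_deriv xs W D = 0"
  by (induction xs) (auto simp: dhouseholder_zero)

lemma hprodl_deriv_eq_sum:
  assumes "distinct xs"
  shows "hprodl_deriv xs W D = (\<Sum>l\<in>set xs. hprodl_deriv xs W (\<lambda>m. if m = l then D l else 0))"
  using assms
proof (induction xs)
  case (Cons x xs)
  have x: "x \<notin> set xs" using Cons.prems by simp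
  have "(\<Sum>l\<in>set xs. hprodl_deriv (x # xs) W (\<lambda>m. if m = l then D l else 0))
     = (\<Sum>l\<in>set xs. householder (W x) ** hprodl_deriv xs W (\<lambda>m. if m = l then D l else 0))"
    using x by (intro sum.cong) (auto simp: dhouseholder_zero)
  also have "\<dots> = householder (W x) ** hprodl_deriv xs W D"
    using Cons by (simp add: bounded_bilinear.sum_right[OF bounded_bilinear_matrix_mult])
  moreover have "hprodl_deriv xs W (\<lambda>m. if m = x then D x else 0) = 0"
    using x by (intro hprodl_deriv_eq_0) auto
  ultimately show ?case
    using x by (simp add: sum.insert)
qed simp

lemma norm_le_norm_add_orthogonal: "w \<bullet> d = 0 \<Longrightarrow> norm w \<le> norm (w + d)"
proof -
  assume "w \<bullet> d = 0"
  hence "(norm (w + d))^2 = (norm w)^2 + (norm d)^2"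
    using norm_add_Pythagorean[of w d] by (simp add: orthogonal_def)
  hence "(norm w)^2 \<le> (norm (w + d))^2" by simp
  thus ?thesis by (simp add: power2_le_iff_abs_le)
qed

lemma norm_hprodl_deriv_le:
  fixes r :: real
  assumes "\<forall>l\<in>set xs. W l \<noteq> 0 \<and> norm (D l) \<le> r * norm (W l)"
  shows "norm (hprodl_deriv xs W D) \<le> 8 * real (length xs) * r"
  using assms
proof (induction xs)
  case (Cons x xs)
  have W: "W x \<noteq> 0" and ratio: "norm (D x) / norm (W x) \<le> r"
    using Cons.prems by (auto simp: divide_le_eq)
  have "norm (dhouseholder (W x) (D x) ** hprodl xs W) = norm (dhouseholder (W x) (D x))"
    using Cons.prems by (intro norm_orthogonal_matrix_mult orthogonal_matrix_hprodl) auto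
  also have "\<dots> \<le> 8 * r" using norm_dhouseholder_le[of "W x" "D x"] ratio by linarith
  finally have "norm (dhouseholder (W x) (D x) ** hprodl xs W) \<le> 8 * r" .
  moreover have "norm (householder (W x) ** hprodl_deriv xs W D) \<le> 8 * real (length xs) * r"
    using Cons by (simp add: norm_orthogonal_matrix_mult orthogonal_matrix_householder[OF W])
  ultimately show ?case
    using norm_triangle_ineq[of "dhouseholder (W x) (D x) ** hprodl xs W"
        "householder (W x) ** hprodl_deriv xs W D"] by (simp add: algebra_simps)
qed simp

lemma norm_hprodl_diff_le:
  fixes r :: real
  assumes "\<forall>l\<in>set xs. W l \<noteq> 0 \<and> W l \<bullet> D l = 0 \<and> norm (D l) \<le> r * norm (W l)"
  shows "norm (hprodl xs (\<lambda>l. W l + D l) - hprodl xs W) \<le> 14 * real (length xs) * r"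
  using assms
proof (induction xs)
  case (Cons x xs)
  have W: "W x \<noteq> 0" and orth: "W x \<bullet> D x = 0" and ratio: "norm (D x) / norm (W x) \<le> r"
    using Cons.prems by (auto simp: divide_le_eq)
  have "orthogonal_matrix (hprodl xs (\<lambda>l. W l + D l))"
    using Cons.prems norm_le_norm_add_orthogonal by (intro orthogonal_matrix_hprodl) force
  hence "norm ((householder (W x + D x) - householder (W x)) ** hprodl xs (\<lambda>l. W l + D l))
      = norm (householder (W x + D x) - householder (W x))"
    by (rule norm_orthogonal_matrix_mult)
  also have "\<dots> \<le> 14 * r"
    using norm_householder_diff_le_ratio[OF W orth] ratio by linarith
  finally have "norm ((householder (W x + D x) - householder (W x)) ** hprodl xs (\<lambda>l. W l + D l))
      \<le> 14 * r" .
  moreover have "norm (householder (W x) ** (hprodl xs (\<lambda>l. W l + D l) - hprodl xs W))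
      \<le> 14 * real (length xs) * r"
    using Cons by (simp add: norm_orthogonal_matrix_mult orthogonal_matrix_householder[OF W])
  moreover have "hprodl (x # xs) (\<lambda>l. W l + D l) - hprodl (x # xs) W
      = (householder (W x + D x) - householder (W x)) ** hprodl xs (\<lambda>l. W l + D l)
        + householder (W x) ** (hprodl xs (\<lambda>l. W l + D l) - hprodl xs W)"
    by (simp add: bounded_bilinear.diff_left[OF bounded_bilinear_matrix_mult]
        bounded_bilinear.diff_right[OF bounded_bilinear_matrix_mult])
  ultimately show ?case
    using norm_triangle_ineq[of "(householder (W x + D x) - householder (W x)) ** hprodl xs (\<lambda>l. W l + D l)"
        "householder (W x) ** (hprodl xs (\<lambda>l. W l + D l) - hprodl xs W)"]
    by (simp add: algebra_simps)
qed simp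

lemma norm_hprodl_remainder_le:
  fixes r :: real
  assumes "\<forall>l\<in>set xs. W l \<noteq> 0 \<and> W l \<bullet> D l = 0 \<and> norm (D l) \<le> r * norm (W l)"
  shows "norm (hprodl xs (\<lambda>l. W l + D l) - hprodl xs W - hprodl_deriv xs W D)
    \<le> 56 * (real (length xs))^2 * r^2"
  using assms
proof (induction xs)
  case (Cons x xs)
  let ?n = "real (length xs)"
  let ?H1 = "householder (W x + D x)" and ?H0 = "householder (W x)"
    and ?dH = "dhouseholder (W x) (D x)"
  let ?Q1 = "hprodl xs (\<lambda>l. W l + D l)" and ?Q0 = "hprodl xs W" and ?dQ = "hprodl_deriv xs W D"
  have W: "W x \<noteq> 0" and orth: "W x \<bullet> D x = 0" and ratio: "norm (D x) / norm (W x) \<le> r"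
    using Cons.prems by (auto simp: divide_le_eq)
  have r: "r \<ge> 0" using ratio order_trans[of 0 "norm (D x) / norm (W x)" r] by simp
  have "orthogonal_matrix ?Q1"
    using Cons.prems norm_le_norm_add_orthogonal by (intro orthogonal_matrix_hprodl) force
  hence "norm ((?H1 - ?H0 - ?dH) ** ?Q1) = norm (?H1 - ?H0 - ?dH)"
    by (rule norm_orthogonal_matrix_mult)
  also have "\<dots> \<le> 6 * r^2"
    using norm_householder_remainder_le[OF W orth] power_mono[OF ratio, of 2] by simp
  finally have t1: "norm ((?H1 - ?H0 - ?dH) ** ?Q1) \<le> 6 * r^2" .
  have "norm (?dH ** (?Q1 - ?Q0)) \<le> norm ?dH * norm (?Q1 - ?Q0)"
    by (rule norm_matrix_mult_le)
  also have "\<dots> \<le> (8 * r) * (14 * ?n * r)"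
    using norm_dhouseholder_le[of "W x" "D x"] ratio norm_hprodl_diff_le[of xs W D r] Cons.prems r
    by (intro mult_mono) auto
  finally have t2: "norm (?dH ** (?Q1 - ?Q0)) \<le> 112 * ?n * r^2"
    by (simp add: power2_eq_square mult_ac)
  have t3: "norm (?H0 ** (?Q1 - ?Q0 - ?dQ)) \<le> 56 * ?n^2 * r^2"
    using Cons by (simp add: norm_orthogonal_matrix_mult orthogonal_matrix_householder[OF W])
  have eq: "hprodl (x # xs) (\<lambda>l. W l + D l) - hprodl (x # xs) W - hprodl_deriv (x # xs) W D
      = (?H1 - ?H0 - ?dH) ** ?Q1 + ?dH ** (?Q1 - ?Q0) + ?H0 ** (?Q1 - ?Q0 - ?dQ)"
    by (simp add: bounded_bilinear.diff_left[OF bounded_bilinear_matrix_mult]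
        bounded_bilinear.diff_right[OF bounded_bilinear_matrix_mult]
        bounded_bilinear.add_left[OF bounded_bilinear_matrix_mult]
        bounded_bilinear.add_right[OF bounded_bilinear_matrix_mult] algebra_simps)
  have bound: "norm ((?H1 - ?H0 - ?dH) ** ?Q1 + ?dH ** (?Q1 - ?Q0) + ?H0 ** (?Q1 - ?Q0 - ?dQ))
      \<le> 6 * r^2 + 112 * ?n * r^2 + 56 * ?n^2 * r^2"
    by (rule order_trans[OF norm_triangle_le[OF add_mono[OF norm_triangle_ineq order_refl]]])
      (use t1 t2 t3 in linarith)
  have "6 * r^2 + 112 * ?n * r^2 + 56 * ?n^2 * r^2 \<le> 56 * (real (length (x # xs)))^2 * r^2"
    by (simp add: power2_eq_square algebra_simps)
  with bound show ?case unfolding eq by (rule order_trans)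
qed simp

section \<open>Gradients and partial gradients\<close>

lemma adjoint_eq_sum:
  fixes A :: "'a::euclidean_space \<Rightarrow> 'b::euclidean_space"
  assumes "linear A"
  shows "adjoint A y = (\<Sum>b\<in>Basis. (A b \<bullet> y) *\<^sub>R b)"
  by (subst euclidean_representation[symmetric])
    (simp add: adjoint_works[OF assms] inner_commute)

lemma norm_adjoint_le:
  fixes A :: "'a::euclidean_space \<Rightarrow> 'b::euclidean_space"
  assumes "linear A" and "0 \<le> K" and "\<And>x. norm (A x) \<le> K * norm x"
  shows "norm (adjoint A y) \<le> K * norm y"
proof -
  let ?z = "adjoint A y"
  have "norm ?z * norm ?z = ?z \<bullet> ?z" by (simp flip: power2_norm_eq_inner add: power2_eq_square)
  also have "\<dots> = A ?z \<bullet> y" by (rule adjoint_works[OF assms(1)])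
  also have "\<dots> \<le> norm (A ?z) * norm y" by (rule norm_cauchy_schwarz)
  also have "\<dots> \<le> norm ?z * (K * norm y)" using mult_right_mono[OF assms(3)[of ?z] norm_ge_zero[of y]] by (simp add: mult_ac)
  finally show ?thesis
    using assms(2) by (cases "?z = 0") (simp_all add: mult_le_cancel_left_pos)
qed

lemma grad_eqI:
  fixes g :: "'a::euclidean_space \<Rightarrow> real"
  assumes "(g has_derivative (\<lambda>h. h \<bullet> D)) (at x)"
  shows "grad g x = D"
proof -
  have "GDERIV g x :> grad g x"
    unfolding grad_def by (rule someI[of _ D]) (use assms in \<open>simp add: gderiv_def\<close>)
  hence "(\<lambda>h. h \<bullet> grad g x) = (\<lambda>h. h \<bullet> D)"
    using assms by (intro has_derivative_unique) (simp_all add: gderiv_def)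
  hence "(grad g x - D) \<bullet> (grad g x - D) = 0"
    by (metis inner_diff_right right_minus_eq)
  thus ?thesis by simp
qed

lemma has_derivative_grad:
  fixes g :: "'a::euclidean_space \<Rightarrow> real"
  assumes "g differentiable (at x)"
  shows "(g has_derivative (\<lambda>h. h \<bullet> grad g x)) (at x)"
proof -
  obtain G where G: "(g has_derivative G) (at x)" using assms by (auto simp: differentiable_def)
  have "G = (\<lambda>h. h \<bullet> adjoint G 1)"
    using has_derivative_linear[OF G] by (simp add: fun_eq_iff adjoint_works)
  with G have "(g has_derivative (\<lambda>h. h \<bullet> adjoint G 1)) (at x)" by simp
  with grad_eqI[OF this] show ?thesis by simp
qed

declare upt_Suc [simp del]

definition hprodl_pderiv :: "nat list \<Rightarrow> (nat \<Rightarrow> real^'n) \<Rightarrow> nat \<Rightarrow> real^'n \<Rightarrow> real^'n^'n" where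
  "hprodl_pderiv xs W l d = hprodl_deriv xs W (\<lambda>m. if m = l then d else 0)"

lemma has_derivative_hprodl_pderiv:
  assumes "\<forall>m\<in>set xs. W m \<noteq> 0"
  shows "((\<lambda>w. hprodl xs (W(l := w))) has_derivative hprodl_pderiv xs W l) (at (W l))"
proof -
  have "((\<lambda>w. (W(l := w)) m) has_derivative (\<lambda>h. if m = l then h else 0)) (at (W l))" for m
    by (cases "m = l") (auto intro: derivative_eq_intros)
  hence "((\<lambda>w. hprodl xs (W(l := w))) has_derivative
      (\<lambda>h. hprodl_deriv xs (W(l := W l)) (\<lambda>m. if m = l then h else 0))) (at (W l))"
    using assms by (intro has_derivative_hprodl) auto
  thus ?thesis by (simp add: hprodl_pderiv_def[abs_def])
qed

lemma linear_hprodl_pderiv: "\<forall>m\<in>set xs. W m \<noteq> 0 \<Longrightarrow> linear (hprodl_pderiv xs W l)"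
  using has_derivative_hprodl_pderiv has_derivative_linear by blast


lemma hprodl_pderiv_self: "hprodl_pderiv xs W l (W l) = 0"
proof -
  have "dhouseholder (W m) (if m = l then W l else 0) = 0" for m
    by (simp add: dhouseholder_self dhouseholder_zero)
  hence "hprodl_deriv xs W (\<lambda>m. if m = l then W l else 0) = 0"
    by (induction xs) simp_all
  thus ?thesis by (simp add: hprodl_pderiv_def)
qed

lemma norm_hprodl_pderiv_le:
  assumes "\<forall>m\<in>set xs. W m \<noteq> 0"
  shows "norm (hprodl_pderiv xs W l d) \<le> 8 * real (length xs) * (norm d / norm (W l))"
  unfolding hprodl_pderiv_def using assms
  by (intro norm_hprodl_deriv_le) auto

lemma pgrad_eq_adjoint:
  assumes V: "\<forall>m\<in>{1..L}. V m \<noteq> 0" and g: "g differentiable (at (hprod L V))"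
  shows "pgrad g L V l = adjoint (hprodl_pderiv [1..<Suc L] V l) (grad g (hprod L V))"
proof -
  let ?xs = "[1..<Suc L]"
  have V': "\<forall>m\<in>set ?xs. V m \<noteq> 0" using V by simp
  have "(g has_derivative (\<lambda>h. h \<bullet> grad g (hprod L V))) (at (hprodl ?xs (V(l := V l))))"
    using has_derivative_grad[OF g] by (simp add: hprod_eq_hprodl)
  from has_derivative_compose[OF has_derivative_hprodl_pderiv[OF V'] this]
  have "((\<lambda>w. g (hprodl ?xs (V(l := w)))) has_derivative
      (\<lambda>h. hprodl_pderiv ?xs V l h \<bullet> grad g (hprod L V))) (at (V l))" .
  also have "(\<lambda>h. hprodl_pderiv ?xs V l h \<bullet> grad g (hprod L V))
      = (\<lambda>h. h \<bullet> adjoint (hprodl_pderiv ?xs V l) (grad g (hprod L V)))"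
    by (simp only: adjoint_works[OF linear_hprodl_pderiv[OF V']])
  finally show ?thesis unfolding pgrad_def hprod_eq_hprodl by (rule grad_eqI)
qed

lemma inner_pgrad_self:
  assumes "\<forall>m\<in>{1..L}. V m \<noteq> 0" and "g differentiable (at (hprod L V))"
  shows "V l \<bullet> pgrad g L V l = 0"
  using assms
  by (simp add: pgrad_eq_adjoint adjoint_works linear_hprodl_pderiv hprodl_pderiv_self)

lemma inner_grad_hprodl_deriv:
  assumes V: "\<forall>m\<in>{1..L}. V m \<noteq> 0" and g: "g differentiable (at (hprod L V))"
  shows "grad g (hprod L V) \<bullet> hprodl_deriv [1..<Suc L] V D = (\<Sum>l=1..L. pgrad g L V l \<bullet> D l)"
proof -
  let ?xs = "[1..<Suc L]"
  have "grad g (hprod L V) \<bullet> hprodl_deriv ?xs V D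
      = (\<Sum>l\<in>set ?xs. grad g (hprod L V) \<bullet> hprodl_pderiv ?xs V l (D l))"
    by (subst hprodl_deriv_eq_sum) (simp_all only: distinct_upt hprodl_pderiv_def inner_sum_right)
  also have "\<dots> = (\<Sum>l\<in>set ?xs. pgrad g L V l \<bullet> D l)"
    using V by (simp add: pgrad_eq_adjoint[OF V g] adjoint_works linear_hprodl_pderiv inner_commute)
  finally show ?thesis by (simp only: set_upt atLeastLessThanSuc_atLeastAtMost)
qed

section \<open>The descent lemma\<close>

lemma orthogonal_matrix_hprodl_line:
  assumes "\<forall>m\<in>set xs. V m \<noteq> 0 \<and> V m \<bullet> D m = 0"
  shows "orthogonal_matrix (hprodl xs (\<lambda>m. V m + t *\<^sub>R D m))"
  using assms norm_le_norm_add_orthogonal[of "V m" "t *\<^sub>R D m" for m]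
  by (intro orthogonal_matrix_hprodl) fastforce

lemma has_derivative_hprodl_line:
  assumes "\<forall>m\<in>set xs. V m \<noteq> 0 \<and> V m \<bullet> D m = 0"
  shows "((\<lambda>t. hprodl xs (\<lambda>m. V m + t *\<^sub>R D m)) has_derivative
    (\<lambda>h. h *\<^sub>R hprodl_deriv xs (\<lambda>m. V m + t *\<^sub>R D m) D)) (at t)"
proof -
  have "V m + t *\<^sub>R D m \<noteq> 0" if "m \<in> set xs" for m
    using assms that norm_le_norm_add_orthogonal[of "V m" "t *\<^sub>R D m"] by fastforce
  hence deriv: "((\<lambda>t. hprodl xs (\<lambda>m. V m + t *\<^sub>R D m)) has_derivative
      (\<lambda>h. hprodl_deriv xs (\<lambda>m. V m + t *\<^sub>R D m) (\<lambda>m. h *\<^sub>R D m))) (at t)"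
    by (intro has_derivative_hprodl) (auto intro!: derivative_eq_intros)
  moreover have "hprodl_deriv xs (\<lambda>m. V m + t *\<^sub>R D m) (\<lambda>m. h *\<^sub>R D m)
      = h *\<^sub>R hprodl_deriv xs (\<lambda>m. V m + t *\<^sub>R D m) D" for h
    using linear_scale[OF has_derivative_linear[OF deriv], of h 1] by simp
  ultimately show ?thesis by simp
qed

lemma norm_hprodl_line_le:
  fixes r t :: real
  assumes VD: "\<forall>m\<in>set xs. V m \<noteq> 0 \<and> V m \<bullet> D m = 0 \<and> norm (D m) \<le> r * norm (V m)"
    and "0 \<le> r" and "0 \<le> t" "t \<le> 1"
  shows "norm (hprodl_deriv xs (\<lambda>m. V m + t *\<^sub>R D m) D) \<le> 8 * real (length xs) * r"
    and "norm (hprodl xs (\<lambda>m. V m + t *\<^sub>R D m) - hprodl xs V) \<le> 14 * real (length xs) * r"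
proof -
  have "\<forall>m\<in>set xs. V m + t *\<^sub>R D m \<noteq> 0 \<and> norm (D m) \<le> r * norm (V m + t *\<^sub>R D m)"
  proof
    fix m assume m: "m \<in> set xs"
    have "norm (V m) \<le> norm (V m + t *\<^sub>R D m)"
      using VD m by (intro norm_le_norm_add_orthogonal) simp
    moreover have "norm (D m) \<le> r * norm (V m)" and "V m \<noteq> 0" using VD m by auto
    ultimately show "V m + t *\<^sub>R D m \<noteq> 0 \<and> norm (D m) \<le> r * norm (V m + t *\<^sub>R D m)"
      using \<open>0 \<le> r\<close> by (metis mult_left_mono norm_le_zero_iff order_trans)
  qed
  thus "norm (hprodl_deriv xs (\<lambda>m. V m + t *\<^sub>R D m) D) \<le> 8 * real (length xs) * r"
    by (rule norm_hprodl_deriv_le)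
  have "\<forall>m\<in>set xs. V m \<noteq> 0 \<and> V m \<bullet> t *\<^sub>R D m = 0 \<and> norm (t *\<^sub>R D m) \<le> r * norm (V m)"
    using VD \<open>0 \<le> t\<close> \<open>t \<le> 1\<close> by (auto intro: order_trans[OF mult_left_le_one_le])
  thus "norm (hprodl xs (\<lambda>m. V m + t *\<^sub>R D m) - hprodl xs V) \<le> 14 * real (length xs) * r"
    by (rule norm_hprodl_diff_le)
qed

lemma mvt_grad_along_path:
  fixes f :: "'a::euclidean_space \<Rightarrow> real" and X :: "real \<Rightarrow> 'a"
  assumes f: "\<And>t. f differentiable (at (X t))"
    and X: "\<And>t. (X has_derivative (\<lambda>h. h *\<^sub>R X' t)) (at t)"
  obtains \<xi> where "0 < \<xi>" "\<xi> < 1"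
    "f (X 1) - f (X 0) - grad f (X 0) \<bullet> (X 1 - X 0) = X' \<xi> \<bullet> (grad f (X \<xi>) - grad f (X 0))"
proof -
  define \<psi> where "\<psi> t = f (X t) - grad f (X 0) \<bullet> X t" for t
  have deriv: "DERIV \<psi> t :> X' t \<bullet> (grad f (X t) - grad f (X 0))" for t
  proof -
    have "(\<psi> has_derivative (\<lambda>h. (h *\<^sub>R X' t) \<bullet> grad f (X t) - grad f (X 0) \<bullet> (h *\<^sub>R X' t))) (at t)"
      unfolding \<psi>_def[abs_def]
      by (intro has_derivative_diff has_derivative_compose[OF X has_derivative_grad[OF f]]
          bounded_linear.has_derivative[OF bounded_linear_inner_right X])
    thus ?thesis
      by (rule has_derivative_imp_has_field_derivative) (simp add: algebra_simps inner_commute)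
  qed
  then obtain \<xi> where "0 < \<xi>" "\<xi> < 1" "\<psi> 1 - \<psi> 0 = X' \<xi> \<bullet> (grad f (X \<xi>) - grad f (X 0))"
    using MVT2[of 0 1 \<psi> "\<lambda>t. X' t \<bullet> (grad f (X t) - grad f (X 0))"] deriv by auto
  thus ?thesis by (intro that) (auto simp: \<psi>_def inner_diff_right)
qed

text \<open>The mean value theorem along \<open>t \<mapsto> hprod L (V + t D)\<close> costs \<open>8L \<cdot> M1 \<cdot> 14L\<close>
  (derivative times Lipschitz constant times displacement); the second-order remainder of the
  product costs \<open>56 L\<^sup>2\<close> against the gradient bound \<open>B\<close>.\<close>

lemma descent_hprod:
  fixes f :: "real^'n^'n \<Rightarrow> real" and r :: real
  assumes f: "\<forall>X. f differentiable (at X)"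
    and lip: "\<forall>X1 X2. orthogonal_matrix X1 \<longrightarrow> orthogonal_matrix X2 \<longrightarrow>
                 norm (grad f X1 - grad f X2) \<le> M1 * norm (X1 - X2)"
    and grad_bound: "\<forall>X. orthogonal_matrix X \<longrightarrow> norm (grad f X) \<le> B"
    and "0 \<le> M1" and "0 \<le> r"
    and VD: "\<forall>m\<in>{1..L}. V m \<noteq> 0 \<and> V m \<bullet> D m = 0 \<and> norm (D m) \<le> r * norm (V m)"
  shows "f (hprod L (\<lambda>m. V m + D m))
    \<le> f (hprod L V) + (\<Sum>l=1..L. pgrad f L V l \<bullet> D l) + (112 * M1 + 56 * B) * (real L * r)^2"
proof -
  let ?xs = "[1..<Suc L]"
  have VD': "\<forall>m\<in>set ?xs. V m \<noteq> 0 \<and> V m \<bullet> D m = 0 \<and> norm (D m) \<le> r * norm (V m)"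
    using VD by simp
  define X where "X t = hprodl ?xs (\<lambda>m. V m + t *\<^sub>R D m)" for t
  define X' where "X' t = hprodl_deriv ?xs (\<lambda>m. V m + t *\<^sub>R D m) D" for t
  have X_orth: "orthogonal_matrix (X t)" for t
    unfolding X_def by (rule orthogonal_matrix_hprodl_line) (use VD' in auto)
  have "(X has_derivative (\<lambda>h. h *\<^sub>R X' t)) (at t)" for t
    unfolding X_def[abs_def] X'_def by (rule has_derivative_hprodl_line) (use VD' in auto)
  then obtain \<xi> where \<xi>: "0 < \<xi>" "\<xi> < 1"
    "f (X 1) - f (X 0) - grad f (X 0) \<bullet> (X 1 - X 0) = X' \<xi> \<bullet> (grad f (X \<xi>) - grad f (X 0))"
    using mvt_grad_along_path[of f X X'] f by blast
  have dX: "norm (X' \<xi>) \<le> 8 * real L * r" and dX0: "norm (X \<xi> - X 0) \<le> 14 * real L * r"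
    using norm_hprodl_line_le[OF VD' \<open>0 \<le> r\<close>, of \<xi>] \<xi>(1,2) by (simp_all add: X_def X'_def)
  have "X' \<xi> \<bullet> (grad f (X \<xi>) - grad f (X 0)) \<le> norm (X' \<xi>) * norm (grad f (X \<xi>) - grad f (X 0))"
    by (rule norm_cauchy_schwarz)
  also have "\<dots> \<le> (8 * real L * r) * (M1 * (14 * real L * r))"
  proof (rule mult_mono[OF dX])
    show "norm (grad f (X \<xi>) - grad f (X 0)) \<le> M1 * (14 * real L * r)"
      using lip X_orth mult_left_mono[OF dX0 \<open>0 \<le> M1\<close>] by (meson order_trans)
  qed (use \<open>0 \<le> r\<close> in auto)
  finally have "X' \<xi> \<bullet> (grad f (X \<xi>) - grad f (X 0)) \<le> (8 * real L * r) * (M1 * (14 * real L * r))" .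
  hence first: "f (X 1) - f (X 0) - grad f (X 0) \<bullet> (X 1 - X 0) \<le> 112 * M1 * (real L * r)^2"
    using \<xi>(3) by (simp add: power2_eq_square mult_ac)
  have X0: "X 0 = hprod L V" and X1: "X 1 = hprod L (\<lambda>m. V m + D m)"
    by (simp_all add: X_def hprod_eq_hprodl)
  have "grad f (X 0) \<bullet> (X 1 - X 0 - hprodl_deriv ?xs V D)
      \<le> norm (grad f (X 0)) * norm (X 1 - X 0 - hprodl_deriv ?xs V D)"
    by (rule norm_cauchy_schwarz)
  also have "\<dots> \<le> B * (56 * (real L)^2 * r^2)"
  proof (rule mult_mono)
    show "norm (grad f (X 0)) \<le> B" using grad_bound X_orth by blast
    thus "0 \<le> B" using norm_ge_zero order_trans by blast
    show "norm (X 1 - X 0 - hprodl_deriv ?xs V D) \<le> 56 * (real L)^2 * r^2"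
      using norm_hprodl_remainder_le[OF VD'] by (simp add: X_def)
  qed simp
  finally have second: "grad f (X 0) \<bullet> (X 1 - X 0 - hprodl_deriv ?xs V D) \<le> 56 * B * (real L * r)^2"
    by (simp add: power_mult_distrib)
  have "grad f (X 0) \<bullet> hprodl_deriv ?xs V D = (\<Sum>l=1..L. pgrad f L V l \<bullet> D l)"
    unfolding X0 using VD f by (intro inner_grad_hprodl_deriv) auto
  with first second show ?thesis
    unfolding X0 X1 by (simp add: inner_diff_right algebra_simps)
qed

section \<open>Measurability and integration over a product of probability spaces\<close>

lemma borel_measurable_outer [measurable (raw)]:
  "f \<in> borel_measurable M \<Longrightarrow> g \<in> borel_measurable M \<Longrightarrow> (\<lambda>x. outer (f x) (g x)) \<in> borel_measurable M"
  by (rule borel_measurable_continuous_Pair)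
    (auto intro!: bounded_bilinear.continuous_on[OF bounded_bilinear_outer]
      continuous_on_fst continuous_on_snd continuous_on_id)

lemma borel_measurable_matrix_mult [measurable (raw)]:
  fixes f :: "'a \<Rightarrow> real^'n^'m" and g :: "'a \<Rightarrow> real^'p^'n"
  shows "f \<in> borel_measurable M \<Longrightarrow> g \<in> borel_measurable M \<Longrightarrow> (\<lambda>x. f x ** g x) \<in> borel_measurable M"
  by (rule borel_measurable_continuous_Pair)
    (auto intro!: bounded_bilinear.continuous_on[OF bounded_bilinear_matrix_mult]
      continuous_on_fst continuous_on_snd continuous_on_id)

lemma borel_measurable_householder [measurable (raw)]:
  assumes [measurable]: "f \<in> borel_measurable M"
  shows "(\<lambda>x. householder (f x)) \<in> borel_measurable M"
  unfolding householder_eq_outer by measurable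

lemma borel_measurable_dhouseholder [measurable (raw)]:
  assumes [measurable]: "f \<in> borel_measurable M" "g \<in> borel_measurable M"
  shows "(\<lambda>x. dhouseholder (f x) (g x)) \<in> borel_measurable M"
  unfolding dhouseholder_def by measurable

lemma borel_measurable_hprodl:
  "(\<And>m. (\<lambda>x. W x m) \<in> borel_measurable M) \<Longrightarrow> (\<lambda>x. hprodl xs (W x)) \<in> borel_measurable M"
  by (induction xs) auto

lemma borel_measurable_hprodl_deriv:
  assumes "\<And>m. (\<lambda>x. W x m) \<in> borel_measurable M" "\<And>m. (\<lambda>x. D x m) \<in> borel_measurable M"
  shows "(\<lambda>x. hprodl_deriv xs (W x) (D x)) \<in> borel_measurable M"
proof (induction xs)
  case (Cons a xs)
  have [measurable]: "(\<lambda>x. W x a) \<in> borel_measurable M" "(\<lambda>x. D x a) \<in> borel_measurable M"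
    "(\<lambda>x. hprodl xs (W x)) \<in> borel_measurable M"
    using assms by (auto intro: borel_measurable_hprodl)
  note Cons[measurable]
  show ?case by simp measurable
qed simp

lemma borel_measurable_adjoint:
  fixes A :: "'x \<Rightarrow> 'a::euclidean_space \<Rightarrow> 'b::euclidean_space"
  assumes "\<And>x. x \<in> space M \<Longrightarrow> linear (A x)"
    and [measurable]: "\<And>b. (\<lambda>x. A x b) \<in> borel_measurable M" "y \<in> borel_measurable M"
  shows "(\<lambda>x. adjoint (A x) (y x)) \<in> borel_measurable M"
proof -
  have "(\<lambda>x. \<Sum>b\<in>Basis. (A x b \<bullet> y x) *\<^sub>R b) \<in> borel_measurable M" by measurable
  thus ?thesis by (rule measurable_cong[THEN iffD1, rotated]) (simp add: adjoint_eq_sum assms(1))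
qed

lemma borel_measurable_adjoint_hprodl_pderiv:
  assumes "\<And>x. x \<in> space M \<Longrightarrow> \<forall>m\<in>set xs. W x m \<noteq> 0"
    and "\<And>m. (\<lambda>x. W x m) \<in> borel_measurable M" and "y \<in> borel_measurable M"
  shows "(\<lambda>x. adjoint (hprodl_pderiv xs (W x) l) (y x)) \<in> borel_measurable M"
  using assms
  by (intro borel_measurable_adjoint linear_hprodl_pderiv)
    (auto simp: hprodl_pderiv_def intro!: borel_measurable_hprodl_deriv)

lemma measurable_PiM_update:
  "(\<lambda>(x, X). X(k := x)) \<in> measurable (D \<Otimes>\<^sub>M PiM UNIV (\<lambda>_::'i. D)) (PiM UNIV (\<lambda>_. D))"
proof -
  have "(\<lambda>p i. if i = k then fst p else snd p i) \<in> measurable (D \<Otimes>\<^sub>M PiM UNIV (\<lambda>_::'i. D)) (PiM UNIV (\<lambda>_. D))"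
  proof (rule measurable_PiM_single')
    fix i :: 'i
    show "(\<lambda>p. if i = k then fst p else snd p i) \<in> measurable (D \<Otimes>\<^sub>M PiM UNIV (\<lambda>_. D)) D"
      by (cases "i = k") simp_all
  qed (auto simp: space_pair_measure space_PiM PiE_iff)
  moreover have "(\<lambda>p i. if i = k then fst p else snd p i) = (\<lambda>(x, X). X(k := x))"
    by (auto simp: fun_eq_iff)
  ultimately show ?thesis by metis
qed

context
  fixes D :: "'w measure" and k :: 'i
  assumes D: "prob_space D"
begin

interpretation D: prob_space D by (fact D)
interpretation PiD: prob_space "PiM UNIV (\<lambda>_::'i. D)" by (rule prob_space_PiM) (use D in auto)
interpretation pair_sigma_finite D "PiM UNIV (\<lambda>_::'i. D)" ..

lemma distr_PiM_update:
  "distr (D \<Otimes>\<^sub>M PiM UNIV (\<lambda>_::'i. D)) (PiM UNIV (\<lambda>_. D)) (\<lambda>(x, X). X(k := x)) = PiM UNIV (\<lambda>_. D)"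
  using distr_pair_PiM_eq_PiM[of UNIV "\<lambda>_. D" k] D by simp

lemma nn_integral_PiM_fresh_coordinate:
  fixes \<Phi> :: "('i \<Rightarrow> 'w) \<Rightarrow> 'w \<Rightarrow> ennreal"
  assumes meas: "(\<lambda>(x, X). \<Phi> X x) \<in> borel_measurable (D \<Otimes>\<^sub>M PiM UNIV (\<lambda>_::'i. D))"
    and fresh: "\<And>X y x. \<Phi> (X(k := y)) x = \<Phi> X x"
  shows "(\<integral>\<^sup>+\<omega>. \<Phi> \<omega> (\<omega> k) \<partial>PiM UNIV (\<lambda>_. D)) = (\<integral>\<^sup>+X. (\<integral>\<^sup>+x. \<Phi> X x \<partial>D) \<partial>PiM UNIV (\<lambda>_. D))"
proof -
  let ?\<mu> = "PiM UNIV (\<lambda>_::'i. D)"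
  have "(\<lambda>\<omega>. \<Phi> \<omega> (\<omega> k)) \<in> borel_measurable ?\<mu>"
    using measurable_compose[of "\<lambda>\<omega>. (\<omega> k, \<omega>)" _ "D \<Otimes>\<^sub>M ?\<mu>", OF _ meas] by simp
  hence "(\<integral>\<^sup>+\<omega>. \<Phi> \<omega> (\<omega> k) \<partial>?\<mu>)
      = (\<integral>\<^sup>+p. \<Phi> ((\<lambda>(x, X). X(k := x)) p) ((\<lambda>(x, X). X(k := x)) p k) \<partial>(D \<Otimes>\<^sub>M ?\<mu>))"
    by (subst (1) distr_PiM_update[symmetric], intro nn_integral_distr[OF measurable_PiM_update])
      (simp add: distr_PiM_update)
  also have "\<dots> = (\<integral>\<^sup>+p. (\<lambda>(x, X). \<Phi> X x) p \<partial>(D \<Otimes>\<^sub>M ?\<mu>))"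
    by (rule nn_integral_cong) (auto simp: fresh split: prod.splits)
  also have "\<dots> = (\<integral>\<^sup>+X. (\<integral>\<^sup>+x. \<Phi> X x \<partial>D) \<partial>?\<mu>)"
    using nn_integral_snd[OF meas] by simp
  finally show ?thesis .
qed

lemma integral_PiM_fresh_coordinate:
  fixes \<Phi> :: "('i \<Rightarrow> 'w) \<Rightarrow> 'w \<Rightarrow> real"
  assumes int: "integrable (D \<Otimes>\<^sub>M PiM UNIV (\<lambda>_::'i. D)) (\<lambda>(x, X). \<Phi> X x)"
    and fresh: "\<And>X y x. \<Phi> (X(k := y)) x = \<Phi> X x"
  shows "(\<integral>\<omega>. \<Phi> \<omega> (\<omega> k) \<partial>PiM UNIV (\<lambda>_. D)) = (\<integral>X. (\<integral>x. \<Phi> X x \<partial>D) \<partial>PiM UNIV (\<lambda>_. D))"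
proof -
  let ?\<mu> = "PiM UNIV (\<lambda>_::'i. D)"
  have "(\<lambda>\<omega>. \<Phi> \<omega> (\<omega> k)) \<in> borel_measurable ?\<mu>"
    using measurable_compose[of "\<lambda>\<omega>. (\<omega> k, \<omega>)" _ "D \<Otimes>\<^sub>M ?\<mu>", OF _ borel_measurable_integrable[OF int]]
    by simp
  hence "(\<integral>\<omega>. \<Phi> \<omega> (\<omega> k) \<partial>?\<mu>)
      = (\<integral>p. \<Phi> ((\<lambda>(x, X). X(k := x)) p) ((\<lambda>(x, X). X(k := x)) p k) \<partial>(D \<Otimes>\<^sub>M ?\<mu>))"
    by (subst (1) distr_PiM_update[symmetric], intro integral_distr[OF measurable_PiM_update])
      (simp add: distr_PiM_update)
  also have "\<dots> = (\<integral>p. (\<lambda>(x, X). \<Phi> X x) p \<partial>(D \<Otimes>\<^sub>M ?\<mu>))"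
    by (rule Bochner_Integration.integral_cong) (auto simp: fresh split: prod.splits)
  also have "\<dots> = (\<integral>X. (\<integral>x. \<Phi> X x \<partial>D) \<partial>?\<mu>)"
    using integral_snd[of "\<lambda>x X. \<Phi> X x", OF int] by simp
  finally show ?thesis .
qed

end

lemma le_one_plus_square: "(x::real) \<le> 1 + x^2"
proof -
  have "0 \<le> (x - 1/2)^2" by simp
  thus ?thesis by (simp add: power2_eq_square algebra_simps)
qed

lemma min_mult_sum_le_of_descent:
  fixes E A s :: "nat \<Rightarrow> real"
  assumes descent: "\<And>k. E (Suc k) \<le> E k - s k * A k + C * (s k)^2"
    and bounded: "\<And>k. \<bar>E k\<bar> \<le> B" and "\<And>k. 0 \<le> s k" and "0 < K"
  shows "Min (A ` {..<K}) * (\<Sum>k<K. s k) \<le> 2 * B + C * (\<Sum>k<K. (s k)^2)"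
proof -
  have telescope: "(\<Sum>k<n. s k * A k) \<le> E 0 - E n + C * (\<Sum>k<n. (s k)^2)" for n
  proof (induction n)
    case (Suc n)
    thus ?case using descent[of n] by (simp add: algebra_simps)
  qed simp
  have "Min (A ` {..<K}) * (\<Sum>k<K. s k) = (\<Sum>k<K. s k * Min (A ` {..<K}))"
    by (simp add: sum_distrib_right mult.commute)
  also have "\<dots> \<le> (\<Sum>k<K. s k * A k)"
    using \<open>0 < K\<close> assms(3) by (intro sum_mono mult_left_mono Min_le) auto
  also have "\<dots> \<le> 2 * B + C * (\<Sum>k<K. (s k)^2)"
    using telescope[of K] bounded[of 0] bounded[of K] by linarith
  finally show ?thesis .
qed

lemma sqrt_le_sum_inverse_sqrt: "sqrt (real K) \<le> (\<Sum>k<K. 1 / sqrt (real (Suc k)))"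
proof -
  have "sqrt (real K) = (\<Sum>k<K. 1 / sqrt (real K))"
    by (cases "K = 0") (simp_all add: real_div_sqrt)
  also have "\<dots> \<le> (\<Sum>k<K. 1 / sqrt (real (Suc k)))"
    by (intro sum_mono divide_left_mono real_sqrt_le_mono) auto
  finally show ?thesis .
qed

lemma sum_inverse_sqrt_sq_le_ln:
  assumes "1 \<le> K"
  shows "(\<Sum>k<K. (1 / sqrt (real (Suc k)))^2) \<le> 1 + ln (real K)"
proof -
  have "(\<Sum>k<K. (1 / sqrt (real (Suc k)))^2) = harm K"
    by (simp add: harm_altdef power_divide inverse_eq_divide)
  also have "\<dots> \<le> 1 + ln (real K)"
    using euler_mascheroni_sequence_decreasing[of 1 K] assms by (simp add: harm_def)
  finally show ?thesis .
qed

section \<open>The stochastic gradient iteration\<close>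

locale householder_sgd =
  fixes f :: "real^'n^'n \<Rightarrow> real"
    and ft :: "'w \<Rightarrow> real^'n^'n \<Rightarrow> real"
    and D :: "'w measure"
    and L :: nat and V0 :: "nat \<Rightarrow> real^'n" and M1 M2 :: real
  assumes f_diff: "\<forall>X. f differentiable (at X)"
    and M1_pos: "M1 > 0"
    and f_lip: "\<forall>X1 X2. orthogonal_matrix X1 \<longrightarrow> orthogonal_matrix X2 \<longrightarrow>
                 norm (grad f X1 - grad f X2) \<le> M1 * norm (X1 - X2)"
    and D_prob: "prob_space D"
    and ft_diff: "\<forall>\<omega>\<in>space D. \<forall>X. ft \<omega> differentiable (at X)"
    and ft_meas: "(\<lambda>(\<omega>, X). grad (ft \<omega>) X) \<in> borel_measurable (D \<Otimes>\<^sub>M borel)"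
    and unbiased: "\<forall>X. orthogonal_matrix X \<longrightarrow> (\<integral>\<omega>. grad (ft \<omega>) X \<partial>D) = grad f X"
    and M2_pos: "M2 > 0"
    and second_moment: "\<forall>X. orthogonal_matrix X \<longrightarrow>
                 (\<integral>\<^sup>+\<omega>. ennreal ((norm (grad (ft \<omega>) X))^2) \<partial>D) \<le> ennreal M2"
    and V0_nz: "\<forall>l\<in>{1..L}. V0 l \<noteq> 0"
begin

abbreviation "\<mu> \<equiv> PiM UNIV (\<lambda>_::nat. D)"
abbreviation "iter \<omega> k \<equiv> sgd_iter ft L V0 \<omega> k"
abbreviation "xs \<equiv> [1..<Suc L]"

definition step :: "nat \<Rightarrow> real" where "step k = 1 / sqrt (real (Suc k))"
definition Q :: "nat \<Rightarrow> (nat \<Rightarrow> 'w) \<Rightarrow> real^'n^'n" where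
  "Q k \<omega> = hprod L (iter \<omega> k)"
definition sample_grad :: "nat \<Rightarrow> (nat \<Rightarrow> 'w) \<Rightarrow> real^'n^'n" where
  "sample_grad k \<omega> = grad (ft (\<omega> k)) (Q k \<omega>)"
abbreviation "pgrad_f k \<omega> l \<equiv> pgrad f L (iter \<omega> k) l"
abbreviation "pgrad_sample k \<omega> l \<equiv> pgrad (ft (\<omega> k)) L (iter \<omega> k) l"

sublocale D: prob_space D by (fact D_prob)
sublocale \<mu>: prob_space \<mu> by (rule prob_space_PiM) (use D_prob in auto)

lemma space_coordinate: "\<omega> \<in> space \<mu> \<Longrightarrow> \<omega> k \<in> space D"
  by (auto simp: space_PiM)

lemma norm_V0_le_norm_iter:
  assumes "\<omega> \<in> space \<mu>" and "m \<in> {1..L}"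
  shows "norm (V0 m) \<le> norm (iter \<omega> k m)"
  using assms(2)
proof (induction k arbitrary: m)
  case (Suc k)
  have "\<forall>m\<in>{1..L}. iter \<omega> k m \<noteq> 0"
    using Suc.IH V0_nz by (metis norm_le_zero_iff norm_zero)
  moreover have "ft (\<omega> k) differentiable (at (hprod L (iter \<omega> k)))"
    using ft_diff space_coordinate[OF assms(1)] by blast
  ultimately have "iter \<omega> k m \<bullet> (- step k) *\<^sub>R pgrad_sample k \<omega> m = 0"
    by (simp add: inner_pgrad_self)
  from norm_le_norm_add_orthogonal[OF this]
  have "norm (iter \<omega> k m) \<le> norm (iter \<omega> (Suc k) m)" by (simp add: step_def)
  with Suc show ?case by force
qed simp

lemma iter_nz: "\<omega> \<in> space \<mu> \<Longrightarrow> \<forall>m\<in>{1..L}. iter \<omega> k m \<noteq> 0"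
  using norm_V0_le_norm_iter V0_nz by (metis norm_le_zero_iff norm_zero)

text \<open>The \<open>insert 1\<close> keeps \<open>c0\<close> positive when \<open>L = 0\<close>.\<close>
definition c0 :: real where "c0 = Min (insert 1 ((\<lambda>l. norm (V0 l)) ` {1..L}))"

lemma c0_pos: "c0 > 0"
  unfolding c0_def using V0_nz by (subst Min_gr_iff) auto

lemma c0_le_norm_iter: "\<omega> \<in> space \<mu> \<Longrightarrow> m \<in> {1..L} \<Longrightarrow> c0 \<le> norm (iter \<omega> k m)"
  unfolding c0_def using norm_V0_le_norm_iter by (meson Min_le finite_imageI finite_atLeastAtMost
      finite_insert image_eqI insertI2 order_trans)

lemma orthogonal_matrix_Q: "\<omega> \<in> space \<mu> \<Longrightarrow> orthogonal_matrix (Q k \<omega>)"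
  unfolding Q_def hprod_eq_hprodl using iter_nz by (intro orthogonal_matrix_hprodl) auto

lemma pgrad_f_eq_adjoint:
  "\<omega> \<in> space \<mu> \<Longrightarrow> pgrad_f k \<omega> l = adjoint (hprodl_pderiv xs (iter \<omega> k) l) (grad f (Q k \<omega>))"
  using iter_nz f_diff by (simp add: pgrad_eq_adjoint Q_def)

lemma pgrad_sample_eq_adjoint:
  "\<omega> \<in> space \<mu> \<Longrightarrow> pgrad_sample k \<omega> l = adjoint (hprodl_pderiv xs (iter \<omega> k) l) (sample_grad k \<omega>)"
  using iter_nz ft_diff space_coordinate by (simp add: pgrad_eq_adjoint Q_def sample_grad_def)

lemma norm_adjoint_pderiv_iter_le:
  assumes "\<omega> \<in> space \<mu>" and "l \<in> {1..L}"
  shows "norm (adjoint (hprodl_pderiv xs (iter \<omega> k) l) y) \<le> 8 * real L / c0 * norm y"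
proof (rule norm_adjoint_le)
  have nz: "\<forall>m\<in>set xs. iter \<omega> k m \<noteq> 0" using iter_nz[OF assms(1)] by simp
  thus "linear (hprodl_pderiv xs (iter \<omega> k) l)" by (rule linear_hprodl_pderiv)
  show "0 \<le> 8 * real L / c0" using c0_pos by simp
  fix d
  have "norm (hprodl_pderiv xs (iter \<omega> k) l d) \<le> 8 * real L * (norm d / norm (iter \<omega> k l))"
    using norm_hprodl_pderiv_le[OF nz] by simp
  also have "\<dots> \<le> 8 * real L * (norm d / c0)"
    using c0_le_norm_iter[OF assms, of k] c0_pos
    by (intro mult_left_mono divide_left_mono) (auto intro!: mult_pos_pos)
  finally show "norm (hprodl_pderiv xs (iter \<omega> k) l d) \<le> 8 * real L / c0 * norm d" by simp
qed

lemma iter_fresh: "k \<le> j \<Longrightarrow> iter (w(j := y)) k = iter w k"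
  by (induction k) auto

lemma measurable_iter [measurable]: "(\<lambda>\<omega>. iter \<omega> k l) \<in> borel_measurable \<mu>"
proof (induction k arbitrary: l)
  case (Suc k)
  have [measurable]: "(\<lambda>\<omega>. Q k \<omega>) \<in> borel_measurable \<mu>"
    unfolding Q_def hprod_eq_hprodl by (intro borel_measurable_hprodl Suc.IH)
  have "(\<lambda>\<omega>. (\<omega> k, Q k \<omega>)) \<in> measurable \<mu> (D \<Otimes>\<^sub>M borel)" by measurable
  from measurable_compose[OF this ft_meas]
  have "(\<lambda>\<omega>. sample_grad k \<omega>) \<in> borel_measurable \<mu>" by (simp add: sample_grad_def)
  hence "(\<lambda>\<omega>. iter \<omega> k l - step k *\<^sub>R adjoint (hprodl_pderiv xs (iter \<omega> k) l) (sample_grad k \<omega>))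
      \<in> borel_measurable \<mu>"
    using Suc.IH iter_nz by (intro borel_measurable_diff borel_measurable_scaleR borel_measurable_const
        borel_measurable_adjoint_hprodl_pderiv) auto
  thus ?case
    by (rule measurable_cong[THEN iffD1, rotated]) (simp add: pgrad_sample_eq_adjoint step_def)
qed simp

lemma measurable_Q [measurable]: "(\<lambda>\<omega>. Q k \<omega>) \<in> borel_measurable \<mu>"
  unfolding Q_def hprod_eq_hprodl by (intro borel_measurable_hprodl measurable_iter)

lemma measurable_sample_grad_pair:
  "(\<lambda>(x, \<omega>). grad (ft x) (Q k \<omega>)) \<in> borel_measurable (D \<Otimes>\<^sub>M \<mu>)"
proof -
  have "(\<lambda>p. (fst p, Q k (snd p))) \<in> measurable (D \<Otimes>\<^sub>M \<mu>) (D \<Otimes>\<^sub>M borel)" by measurable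
  from measurable_compose[OF this ft_meas] show ?thesis by (simp add: case_prod_beta)
qed

lemma measurable_sample_grad [measurable]: "(\<lambda>\<omega>. sample_grad k \<omega>) \<in> borel_measurable \<mu>"
proof -
  have "(\<lambda>\<omega>. (\<omega> k, Q k \<omega>)) \<in> measurable \<mu> (D \<Otimes>\<^sub>M borel)" by measurable
  from measurable_compose[OF this ft_meas] show ?thesis by (simp add: sample_grad_def)
qed

lemma continuous_on_grad_f: "continuous_on {X. orthogonal_matrix X} (grad f)"
  using f_lip M1_pos by (intro lipschitz_on_continuous_on[of M1] lipschitz_onI) (auto simp: dist_norm)

lemma measurable_grad_f_Q [measurable]: "(\<lambda>\<omega>. grad f (Q k \<omega>)) \<in> borel_measurable \<mu>"
proof -
  have "(\<lambda>\<omega>. if \<omega> \<in> space \<mu> then Q k \<omega> else mat 1) \<in> measurable \<mu> (restrict_space borel {X. orthogonal_matrix X})"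
    by (rule measurable_restrict_space2) (auto simp: orthogonal_matrix_Q orthogonal_matrix_id)
  from measurable_compose[OF this borel_measurable_continuous_on_restrict[OF continuous_on_grad_f]]
  show ?thesis by (rule measurable_cong[THEN iffD1, rotated]) simp
qed

lemma measurable_pgrad_f [measurable]: "(\<lambda>\<omega>. pgrad_f k \<omega> l) \<in> borel_measurable \<mu>"
  using iter_nz
  by (subst measurable_cong[OF pgrad_f_eq_adjoint])
    (auto intro!: borel_measurable_adjoint_hprodl_pderiv)

lemma measurable_pgrad_sample [measurable]: "(\<lambda>\<omega>. pgrad_sample k \<omega> l) \<in> borel_measurable \<mu>"
  using iter_nz
  by (subst measurable_cong[OF pgrad_sample_eq_adjoint])
    (auto intro!: borel_measurable_adjoint_hprodl_pderiv)

lemma bounded_f_grad_f: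
  obtains B where "\<And>X. orthogonal_matrix X \<Longrightarrow> \<bar>f X\<bar> \<le> B"
    "\<And>X. orthogonal_matrix X \<Longrightarrow> norm (grad f X) \<le> B"
proof -
  have "continuous_on {X. orthogonal_matrix X} f"
    using f_diff by (meson continuous_at_imp_continuous_on differentiable_imp_continuous_within)
  then obtain B1 where "\<And>X. orthogonal_matrix X \<Longrightarrow> \<bar>f X\<bar> \<le> B1"
    using bounded_on_orthogonal_matrices by (metis real_norm_def)
  moreover obtain B2 where "\<And>X. orthogonal_matrix X \<Longrightarrow> norm (grad f X) \<le> B2"
    using bounded_on_orthogonal_matrices[OF continuous_on_grad_f] by blast
  ultimately show ?thesis
    using that[of "max B1 B2"] by (meson max.coboundedI1 max.coboundedI2 order_trans)
qed

lemma sgd_step_relative_size: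
  assumes \<omega>: "\<omega> \<in> space \<mu>" and m: "m \<in> {1..L}"
  shows "iter \<omega> k m \<noteq> 0" and "iter \<omega> k m \<bullet> (- step k) *\<^sub>R pgrad_sample k \<omega> m = 0"
    and "norm ((- step k) *\<^sub>R pgrad_sample k \<omega> m)
      \<le> step k * (8 * real L / c0) * norm (sample_grad k \<omega>) / c0 * norm (iter \<omega> k m)"
proof -
  show "iter \<omega> k m \<noteq> 0" using iter_nz[OF \<omega>] m by blast
  show "iter \<omega> k m \<bullet> (- step k) *\<^sub>R pgrad_sample k \<omega> m = 0"
    using iter_nz[OF \<omega>] ft_diff space_coordinate[OF \<omega>] by (simp add: inner_pgrad_self)
  have "norm ((- step k) *\<^sub>R pgrad_sample k \<omega> m)
      = step k * norm (adjoint (hprodl_pderiv xs (iter \<omega> k) m) (sample_grad k \<omega>))"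
    by (simp add: pgrad_sample_eq_adjoint[OF \<omega>] step_def)
  also have "\<dots> \<le> step k * (8 * real L / c0 * norm (sample_grad k \<omega>))"
    using norm_adjoint_pderiv_iter_le[OF \<omega> m, of k "sample_grad k \<omega>"]
    by (intro mult_left_mono) (simp_all add: step_def)
  also have "\<dots> = step k * (8 * real L / c0) * norm (sample_grad k \<omega>) / c0 * c0"
    using c0_pos by simp
  also have "\<dots> \<le> step k * (8 * real L / c0) * norm (sample_grad k \<omega>) / c0 * norm (iter \<omega> k m)"
    using c0_le_norm_iter[OF \<omega> m] c0_pos by (intro mult_left_mono) (simp_all add: step_def)
  finally show "norm ((- step k) *\<^sub>R pgrad_sample k \<omega> m)
      \<le> step k * (8 * real L / c0) * norm (sample_grad k \<omega>) / c0 * norm (iter \<omega> k m)" .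
qed

lemma step_descent:
  obtains C where "0 \<le> C" "\<And>\<omega> k. \<omega> \<in> space \<mu> \<Longrightarrow> f (Q (Suc k) \<omega>)
    \<le> f (Q k \<omega>) - step k * (\<Sum>l=1..L. pgrad_f k \<omega> l \<bullet> pgrad_sample k \<omega> l)
      + C * (step k)^2 * (norm (sample_grad k \<omega>))^2"
proof -
  obtain B where B: "\<And>X. orthogonal_matrix X \<Longrightarrow> norm (grad f X) \<le> B"
    using bounded_f_grad_f by blast
  have "0 \<le> B" using B[OF orthogonal_matrix_id] norm_ge_zero order_trans by blast
  define K where "K = 8 * real L / c0"
  have "0 \<le> K" using c0_pos by (simp add: K_def)
  show ?thesis
  proof (rule that)
    show "0 \<le> (112 * M1 + 56 * B) * (real L * K / c0)^2" using M1_pos \<open>0 \<le> B\<close> by simp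
    fix \<omega> k assume \<omega>: "\<omega> \<in> space \<mu>"
    define Dir where "Dir m = (- step k) *\<^sub>R pgrad_sample k \<omega> m" for m
    define r where "r = step k * K * norm (sample_grad k \<omega>) / c0"
    have "0 \<le> r" using \<open>0 \<le> K\<close> c0_pos by (simp add: r_def step_def)
    have "\<forall>m\<in>{1..L}. iter \<omega> k m \<noteq> 0 \<and> iter \<omega> k m \<bullet> Dir m = 0 \<and> norm (Dir m) \<le> r * norm (iter \<omega> k m)"
      unfolding Dir_def r_def K_def using sgd_step_relative_size[OF \<omega>] by blast
    from descent_hprod[OF f_diff f_lip _ _ \<open>0 \<le> r\<close> this] B M1_pos
    have "f (hprod L (\<lambda>m. iter \<omega> k m + Dir m))
      \<le> f (hprod L (iter \<omega> k)) + (\<Sum>l=1..L. pgrad_f k \<omega> l \<bullet> Dir l) + (112 * M1 + 56 * B) * (real L * r)^2"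
      by simp
    moreover have "hprod L (\<lambda>m. iter \<omega> k m + Dir m) = Q (Suc k) \<omega>"
      by (simp add: Q_def Dir_def step_def)
    moreover have "(\<Sum>l=1..L. pgrad_f k \<omega> l \<bullet> Dir l)
        = - step k * (\<Sum>l=1..L. pgrad_f k \<omega> l \<bullet> pgrad_sample k \<omega> l)"
      by (simp add: Dir_def sum_distrib_left)
    moreover have "(real L * r)^2 = (real L * K / c0)^2 * (step k)^2 * (norm (sample_grad k \<omega>))^2"
      by (simp add: r_def power_mult_distrib power_divide)
    ultimately show "f (Q (Suc k) \<omega>) \<le> f (Q k \<omega>)
        - step k * (\<Sum>l=1..L. pgrad_f k \<omega> l \<bullet> pgrad_sample k \<omega> l)
        + (112 * M1 + 56 * B) * (real L * K / c0)^2 * (step k)^2 * (norm (sample_grad k \<omega>))^2"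
      by (simp add: Q_def mult_ac)
  qed
qed


lemma Q_fresh: "Q k (w(k := y)) = Q k w"
  by (simp add: Q_def iter_fresh)

lemma nn_integral_sample_grad_sq_le:
  "(\<integral>\<^sup>+\<omega>. ennreal ((norm (sample_grad k \<omega>))^2) \<partial>\<mu>) \<le> ennreal M2"
proof -
  have "(\<integral>\<^sup>+\<omega>. ennreal ((norm (sample_grad k \<omega>))^2) \<partial>\<mu>)
      = (\<integral>\<^sup>+X. (\<integral>\<^sup>+x. ennreal ((norm (grad (ft x) (Q k X)))^2) \<partial>D) \<partial>\<mu>)"
    unfolding sample_grad_def
    by (rule nn_integral_PiM_fresh_coordinate[OF D_prob, where \<Phi> = "\<lambda>X x. ennreal ((norm (grad (ft x) (Q k X)))^2)"])
      (use measurable_sample_grad_pair[of k] in \<open>simp_all add: Q_fresh case_prod_beta\<close>)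
  also have "\<dots> \<le> (\<integral>\<^sup>+X. ennreal M2 \<partial>\<mu>)"
    using second_moment orthogonal_matrix_Q by (intro nn_integral_mono) auto
  finally show ?thesis by (simp add: \<mu>.emeasure_space_1)
qed

lemma integrable_sample_grad_sq: "integrable \<mu> (\<lambda>\<omega>. (norm (sample_grad k \<omega>))^2)"
  using nn_integral_sample_grad_sq_le[of k]
  by (intro integrableI_bounded) (auto intro: order.strict_trans1[OF _ ennreal_less_top])

lemma integral_sample_grad_sq_le: "(\<integral>\<omega>. (norm (sample_grad k \<omega>))^2 \<partial>\<mu>) \<le> M2"
proof -
  have "ennreal (\<integral>\<omega>. (norm (sample_grad k \<omega>))^2 \<partial>\<mu>) = (\<integral>\<^sup>+\<omega>. ennreal ((norm (sample_grad k \<omega>))^2) \<partial>\<mu>)"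
    by (rule nn_integral_eq_integral[symmetric]) (auto intro: integrable_sample_grad_sq)
  also have "\<dots> \<le> ennreal M2" by (rule nn_integral_sample_grad_sq_le)
  finally show ?thesis using M2_pos by (simp add: ennreal_le_iff)
qed

lemma nn_integral_norm_grad_ft_le:
  assumes "orthogonal_matrix Y"
  shows "(\<integral>\<^sup>+x. ennreal (norm (grad (ft x) Y)) \<partial>D) \<le> 1 + ennreal M2"
proof -
  have "(\<integral>\<^sup>+x. ennreal (norm (grad (ft x) Y)) \<partial>D) \<le> (\<integral>\<^sup>+x. 1 + ennreal ((norm (grad (ft x) Y))^2) \<partial>D)"
  proof (intro nn_integral_mono)
    fix x
    have "ennreal (norm (grad (ft x) Y)) \<le> ennreal (1 + (norm (grad (ft x) Y))^2)"
      by (intro ennreal_leI le_one_plus_square)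
    thus "ennreal (norm (grad (ft x) Y)) \<le> 1 + ennreal ((norm (grad (ft x) Y))^2)"
      by (simp add: ennreal_plus)
  qed
  also have "\<dots> = 1 + (\<integral>\<^sup>+x. ennreal ((norm (grad (ft x) Y))^2) \<partial>D)"
    using measurable_compose[of "\<lambda>x. (x, Y)" D "D \<Otimes>\<^sub>M borel", OF _ ft_meas]
    by (subst nn_integral_add) (auto simp: D.emeasure_space_1)
  also have "\<dots> \<le> 1 + ennreal M2" using second_moment assms by (auto intro: add_left_mono)
  finally show ?thesis .
qed

lemma integrable_grad_ft: "orthogonal_matrix Y \<Longrightarrow> integrable D (\<lambda>x. grad (ft x) Y)"
  using measurable_compose[of "\<lambda>x. (x, Y)" D "D \<Otimes>\<^sub>M borel", OF _ ft_meas]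
    order.strict_trans1[OF nn_integral_norm_grad_ft_le]
  by (intro integrableI_bounded) (auto simp flip: ennreal_plus)

lemma integrable_norm_grad_ft_pair:
  "integrable (D \<Otimes>\<^sub>M \<mu>) (\<lambda>(x, X). norm (grad (ft x) (Q k X)))"
proof (rule integrableI_bounded)
  interpret pair_sigma_finite D \<mu> ..
  have meas: "(\<lambda>(x, X). ennreal (norm (grad (ft x) (Q k X)))) \<in> borel_measurable (D \<Otimes>\<^sub>M \<mu>)"
    using measurable_sample_grad_pair[of k] by (simp add: case_prod_beta)
  thus "(\<lambda>(x, X). norm (grad (ft x) (Q k X))) \<in> borel_measurable (D \<Otimes>\<^sub>M \<mu>)"
    using measurable_sample_grad_pair[of k] by (simp add: case_prod_beta)
  have "(\<integral>\<^sup>+p. ennreal (norm ((\<lambda>(x, X). norm (grad (ft x) (Q k X))) p)) \<partial>(D \<Otimes>\<^sub>M \<mu>))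
      = (\<integral>\<^sup>+X. (\<integral>\<^sup>+x. ennreal (norm (grad (ft x) (Q k X))) \<partial>D) \<partial>\<mu>)"
    using nn_integral_snd[OF meas] by (simp add: split_beta')
  also have "\<dots> \<le> (\<integral>\<^sup>+X. 1 + ennreal M2 \<partial>\<mu>)"
    by (intro nn_integral_mono nn_integral_norm_grad_ft_le orthogonal_matrix_Q)
  also have "\<dots> < \<infinity>" by (simp add: \<mu>.emeasure_space_1 flip: ennreal_plus)
  finally show "(\<integral>\<^sup>+p. ennreal (norm ((\<lambda>(x, X). norm (grad (ft x) (Q k X))) p)) \<partial>(D \<Otimes>\<^sub>M \<mu>)) < \<infinity>" .
qed

lemma norm_pgrad_f_le:
  obtains B where "0 \<le> B" "\<And>\<omega> k l. \<omega> \<in> space \<mu> \<Longrightarrow> l \<in> {1..L} \<Longrightarrow> norm (pgrad_f k \<omega> l) \<le> B"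
proof -
  obtain B where B: "\<And>X. orthogonal_matrix X \<Longrightarrow> norm (grad f X) \<le> B"
    using bounded_f_grad_f by blast
  have "0 \<le> B" using B[OF orthogonal_matrix_id] norm_ge_zero order_trans by blast
  show ?thesis
  proof (rule that)
    show "0 \<le> 8 * real L / c0 * B" using c0_pos \<open>0 \<le> B\<close> by simp
    fix \<omega> k l assume \<omega>: "\<omega> \<in> space \<mu>" and l: "l \<in> {1..L}"
    have "norm (pgrad_f k \<omega> l) \<le> 8 * real L / c0 * norm (grad f (Q k \<omega>))"
      unfolding pgrad_f_eq_adjoint[OF \<omega>] by (rule norm_adjoint_pderiv_iter_le[OF \<omega> l])
    also have "\<dots> \<le> 8 * real L / c0 * B"
      using B[OF orthogonal_matrix_Q[OF \<omega>]] c0_pos by (intro mult_left_mono) auto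
    finally show "norm (pgrad_f k \<omega> l) \<le> 8 * real L / c0 * B" .
  qed
qed

lemma integral_inner_adjoint_grad_ft:
  assumes "X \<in> space \<mu>"
  shows "(\<integral>x. pgrad_f k X l \<bullet> adjoint (hprodl_pderiv xs (iter X k) l) (grad (ft x) (Q k X)) \<partial>D)
    = (norm (pgrad_f k X l))^2"
proof -
  let ?A = "hprodl_pderiv xs (iter X k) l"
  have lin: "linear ?A" using iter_nz[OF assms] by (intro linear_hprodl_pderiv) simp
  have "(\<integral>x. pgrad_f k X l \<bullet> adjoint ?A (grad (ft x) (Q k X)) \<partial>D)
      = (\<integral>x. ?A (pgrad_f k X l) \<bullet> grad (ft x) (Q k X) \<partial>D)"
    by (simp only: adjoint_works[OF lin])
  also have "\<dots> = ?A (pgrad_f k X l) \<bullet> (\<integral>x. grad (ft x) (Q k X) \<partial>D)"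
    using orthogonal_matrix_Q[OF assms] by (intro integral_inner_right integrable_grad_ft)
  also have "\<dots> = ?A (pgrad_f k X l) \<bullet> grad f (Q k X)"
    using unbiased orthogonal_matrix_Q[OF assms] by simp
  also have "\<dots> = pgrad_f k X l \<bullet> pgrad_f k X l"
    by (simp only: adjoint_works[OF lin] pgrad_f_eq_adjoint[OF assms])
  finally show ?thesis by (simp add: power2_norm_eq_inner)
qed

lemma norm_inner_pgrad_adjoint_le:
  assumes l: "l \<in> {1..L}"
  obtains K where "0 \<le> K" "\<And>X y. X \<in> space \<mu> \<Longrightarrow>
    norm (pgrad_f k X l \<bullet> adjoint (hprodl_pderiv xs (iter X k) l) y) \<le> K * norm y"
proof -
  obtain B where "0 \<le> B" and B: "\<And>\<omega>. \<omega> \<in> space \<mu> \<Longrightarrow> norm (pgrad_f k \<omega> l) \<le> B"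
    using norm_pgrad_f_le l by metis
  show ?thesis
  proof (rule that)
    show "0 \<le> B * (8 * real L / c0)" using \<open>0 \<le> B\<close> c0_pos by simp
    fix X y assume X: "X \<in> space \<mu>"
    have "norm (pgrad_f k X l \<bullet> adjoint (hprodl_pderiv xs (iter X k) l) y)
        \<le> norm (pgrad_f k X l) * norm (adjoint (hprodl_pderiv xs (iter X k) l) y)"
      unfolding real_norm_def by (rule Cauchy_Schwarz_ineq2)
    also have "\<dots> \<le> B * (8 * real L / c0 * norm y)"
      using B[OF X] norm_adjoint_pderiv_iter_le[OF X l] \<open>0 \<le> B\<close> by (intro mult_mono) auto
    finally show "norm (pgrad_f k X l \<bullet> adjoint (hprodl_pderiv xs (iter X k) l) y)
        \<le> B * (8 * real L / c0) * norm y" by simp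
  qed
qed

lemma integrable_inner_adjoint_pair:
  assumes l: "l \<in> {1..L}"
  shows "integrable (D \<Otimes>\<^sub>M \<mu>)
    (\<lambda>(x, X). pgrad_f k X l \<bullet> adjoint (hprodl_pderiv xs (iter X k) l) (grad (ft x) (Q k X)))"
proof -
  obtain K where "0 \<le> K" and K: "\<And>X y. X \<in> space \<mu> \<Longrightarrow>
      norm (pgrad_f k X l \<bullet> adjoint (hprodl_pderiv xs (iter X k) l) y) \<le> K * norm y"
    using norm_inner_pgrad_adjoint_le[OF l] by metis
  have "(\<lambda>p. adjoint (hprodl_pderiv xs (iter (snd p) k) l) (grad (ft (fst p)) (Q k (snd p))))
      \<in> borel_measurable (D \<Otimes>\<^sub>M \<mu>)"
    using measurable_sample_grad_pair[of k] iter_nz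
    by (intro borel_measurable_adjoint_hprodl_pderiv) (auto simp: space_pair_measure split_beta')
  hence meas: "(\<lambda>(x, X). pgrad_f k X l \<bullet> adjoint (hprodl_pderiv xs (iter X k) l) (grad (ft x) (Q k X)))
      \<in> borel_measurable (D \<Otimes>\<^sub>M \<mu>)"
    unfolding split_beta' by measurable
  have int: "integrable (D \<Otimes>\<^sub>M \<mu>) (\<lambda>(x, X). K * norm (grad (ft x) (Q k X)))"
    using integrable_norm_grad_ft_pair[of k] by (simp add: split_beta')
  have "AE p in D \<Otimes>\<^sub>M \<mu>.
      norm ((\<lambda>(x, X). pgrad_f k X l \<bullet> adjoint (hprodl_pderiv xs (iter X k) l) (grad (ft x) (Q k X))) p)
      \<le> norm ((\<lambda>(x, X). K * norm (grad (ft x) (Q k X))) p)"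
    using K \<open>0 \<le> K\<close> by (intro AE_I2) (auto simp: space_pair_measure)
  with int meas show ?thesis by (rule Bochner_Integration.integrable_bound)
qed

text \<open>The sample \<open>\<omega> k\<close> does not enter the iterate at step \<open>k\<close>, so it can be integrated
  out first; unbiasedness then turns \<open>pgrad_sample\<close> into \<open>pgrad_f\<close>.\<close>

lemma integral_inner_pgrad:
  assumes l: "l \<in> {1..L}"
  shows "integrable \<mu> (\<lambda>\<omega>. pgrad_f k \<omega> l \<bullet> pgrad_sample k \<omega> l)"
    and "(\<integral>\<omega>. pgrad_f k \<omega> l \<bullet> pgrad_sample k \<omega> l \<partial>\<mu>) = (\<integral>\<omega>. (norm (pgrad_f k \<omega> l))^2 \<partial>\<mu>)"
proof -
  define \<Phi> where "\<Phi> X x = pgrad_f k X l \<bullet> adjoint (hprodl_pderiv xs (iter X k) l) (grad (ft x) (Q k X))"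
    for X x
  have "\<Phi> (X(k := y)) x = \<Phi> X x" for X y x
    by (simp add: \<Phi>_def Q_fresh iter_fresh)
  with integrable_inner_adjoint_pair[OF l, of k]
  have "(\<integral>\<omega>. \<Phi> \<omega> (\<omega> k) \<partial>\<mu>) = (\<integral>X. (\<integral>x. \<Phi> X x \<partial>D) \<partial>\<mu>)"
    unfolding \<Phi>_def by (intro integral_PiM_fresh_coordinate[OF D_prob]) simp_all
  also have "\<dots> = (\<integral>\<omega>. (norm (pgrad_f k \<omega> l))^2 \<partial>\<mu>)"
    by (intro Bochner_Integration.integral_cong refl) (simp only: \<Phi>_def integral_inner_adjoint_grad_ft)
  also have "(\<integral>\<omega>. \<Phi> \<omega> (\<omega> k) \<partial>\<mu>) = (\<integral>\<omega>. pgrad_f k \<omega> l \<bullet> pgrad_sample k \<omega> l \<partial>\<mu>)"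
    by (intro Bochner_Integration.integral_cong)
      (simp_all add: \<Phi>_def pgrad_sample_eq_adjoint sample_grad_def)
  finally show "(\<integral>\<omega>. pgrad_f k \<omega> l \<bullet> pgrad_sample k \<omega> l \<partial>\<mu>) = (\<integral>\<omega>. (norm (pgrad_f k \<omega> l))^2 \<partial>\<mu>)" .
  obtain K where "0 \<le> K" and K: "\<And>X y. X \<in> space \<mu> \<Longrightarrow>
      norm (pgrad_f k X l \<bullet> adjoint (hprodl_pderiv xs (iter X k) l) y) \<le> K * norm y"
    using norm_inner_pgrad_adjoint_le[OF l] by metis
  show "integrable \<mu> (\<lambda>\<omega>. pgrad_f k \<omega> l \<bullet> pgrad_sample k \<omega> l)"
  proof (rule Bochner_Integration.integrable_bound)
    show "integrable \<mu> (\<lambda>\<omega>. K * (1 + (norm (sample_grad k \<omega>))^2))"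
      using integrable_sample_grad_sq[of k] by simp
    show "AE \<omega> in \<mu>. norm (pgrad_f k \<omega> l \<bullet> pgrad_sample k \<omega> l) \<le> norm (K * (1 + (norm (sample_grad k \<omega>))^2))"
    proof (rule AE_I2)
      fix \<omega> assume \<omega>: "\<omega> \<in> space \<mu>"
      have "norm (pgrad_f k \<omega> l \<bullet> pgrad_sample k \<omega> l) \<le> K * norm (sample_grad k \<omega>)"
        using K[OF \<omega>] by (simp add: pgrad_sample_eq_adjoint[OF \<omega>])
      also have "\<dots> \<le> K * (1 + (norm (sample_grad k \<omega>))^2)"
        using \<open>0 \<le> K\<close> by (intro mult_left_mono le_one_plus_square)
      finally show "norm (pgrad_f k \<omega> l \<bullet> pgrad_sample k \<omega> l) \<le> norm (K * (1 + (norm (sample_grad k \<omega>))^2))"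
        using \<open>0 \<le> K\<close> by simp
    qed
  qed measurable
qed


definition expected_loss :: "nat \<Rightarrow> real" where
  "expected_loss k = (\<integral>\<omega>. f (Q k \<omega>) \<partial>\<mu>)"

definition expected_pgrad_sq :: "nat \<Rightarrow> real" where
  "expected_pgrad_sq k = (\<Sum>l=1..L. \<integral>\<omega>. (norm (pgrad_f k \<omega> l))^2 \<partial>\<mu>)"

lemma expected_pgrad_sq_nonneg: "0 \<le> expected_pgrad_sq k"
  unfolding expected_pgrad_sq_def by (intro sum_nonneg integral_nonneg_AE) auto

lemma bounded_expected_loss:
  obtains B where "\<And>k. \<bar>expected_loss k\<bar> \<le> B" and "\<And>k. integrable \<mu> (\<lambda>\<omega>. f (Q k \<omega>))"
proof -
  obtain B where B: "\<And>X. orthogonal_matrix X \<Longrightarrow> \<bar>f X\<bar> \<le> B"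
    using bounded_f_grad_f by blast
  have meas: "(\<lambda>\<omega>. f (Q k \<omega>)) \<in> borel_measurable \<mu>" for k
    using f_diff by (intro measurable_compose[OF measurable_Q] borel_measurable_continuous_onI
        continuous_at_imp_continuous_on) (auto intro: differentiable_imp_continuous_within)
  have int: "integrable \<mu> (\<lambda>\<omega>. f (Q k \<omega>))" for k
    using B orthogonal_matrix_Q by (intro \<mu>.integrable_const_bound[where B = B] meas) auto
  have bnd: "\<bar>expected_loss k\<bar> \<le> B" for k
  proof -
    have "\<bar>expected_loss k\<bar> \<le> (\<integral>\<omega>. \<bar>f (Q k \<omega>)\<bar> \<partial>\<mu>)"
      unfolding expected_loss_def using integral_norm_bound[of \<mu> "\<lambda>\<omega>. f (Q k \<omega>)"] by simp
    also have "\<dots> \<le> (\<integral>\<omega>. B \<partial>\<mu>)"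
      using int B orthogonal_matrix_Q by (intro integral_mono) auto
    finally show ?thesis by (simp add: \<mu>.prob_space)
  qed
  show ?thesis by (rule that[OF bnd int])
qed

lemma expected_descent:
  obtains C where "0 \<le> C"
    "\<And>k. expected_loss (Suc k) \<le> expected_loss k - step k * expected_pgrad_sq k + C * (step k)^2"
proof -
  obtain C where "0 \<le> C" and C: "\<And>\<omega> k. \<omega> \<in> space \<mu> \<Longrightarrow> f (Q (Suc k) \<omega>)
    \<le> f (Q k \<omega>) - step k * (\<Sum>l=1..L. pgrad_f k \<omega> l \<bullet> pgrad_sample k \<omega> l)
      + C * (step k)^2 * (norm (sample_grad k \<omega>))^2"
    using step_descent by blast
  obtain int_f: "\<And>k. integrable \<mu> (\<lambda>\<omega>. f (Q k \<omega>))" using bounded_expected_loss by blast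
  show ?thesis
  proof (rule that)
    show "0 \<le> C * M2" using \<open>0 \<le> C\<close> M2_pos by simp
    fix k
    have int_inner: "integrable \<mu> (\<lambda>\<omega>. \<Sum>l=1..L. pgrad_f k \<omega> l \<bullet> pgrad_sample k \<omega> l)"
      using integral_inner_pgrad(1) by auto
    have "expected_loss (Suc k) \<le> (\<integral>\<omega>. f (Q k \<omega>) - step k * (\<Sum>l=1..L. pgrad_f k \<omega> l \<bullet> pgrad_sample k \<omega> l)
        + C * (step k)^2 * (norm (sample_grad k \<omega>))^2 \<partial>\<mu>)"
      unfolding expected_loss_def using C int_f int_inner integrable_sample_grad_sq
      by (intro integral_mono) auto
    also have "\<dots> = expected_loss k - step k * expected_pgrad_sq k
        + C * (step k)^2 * (\<integral>\<omega>. (norm (sample_grad k \<omega>))^2 \<partial>\<mu>)"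
      using int_f int_inner integrable_sample_grad_sq integral_inner_pgrad
      by (simp add: expected_loss_def expected_pgrad_sq_def integral_sum)
    also have "\<dots> \<le> expected_loss k - step k * expected_pgrad_sq k + C * M2 * (step k)^2"
      using mult_left_mono[OF integral_sample_grad_sq_le[of k], of "C * (step k)^2"] \<open>0 \<le> C\<close>
      by (simp add: mult_ac)
    finally show "expected_loss (Suc k) \<le> expected_loss k - step k * expected_pgrad_sq k + C * M2 * (step k)^2" .
  qed
qed


lemma min_expected_pgrad_sq_nonneg: "0 < K \<Longrightarrow> 0 \<le> Min (expected_pgrad_sq ` {..<K})"
  using expected_pgrad_sq_nonneg by (subst Min_ge_iff) auto

lemma min_expected_pgrad_sq_little_o:
  assumes "0 < \<epsilon>"
  shows "(\<lambda>K. Min (expected_pgrad_sq ` {..<K})) \<in> o(\<lambda>K. real K powr (\<epsilon> - 1/2))"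
proof -
  obtain C where "0 \<le> C" and descent:
    "\<And>k. expected_loss (Suc k) \<le> expected_loss k - step k * expected_pgrad_sq k + C * (step k)^2"
    using expected_descent by blast
  obtain B where bounded: "\<And>k. \<bar>expected_loss k\<bar> \<le> B"
    using bounded_expected_loss by blast
  have bound: "Min (expected_pgrad_sq ` {..<K}) \<le> (2 * B + C + C * ln (real K)) / sqrt (real K)"
    if K: "1 \<le> K" for K
  proof -
    let ?m = "Min (expected_pgrad_sq ` {..<K})"
    have "?m * sqrt (real K) \<le> ?m * (\<Sum>k<K. step k)"
      using sqrt_le_sum_inverse_sqrt min_expected_pgrad_sq_nonneg K
      by (intro mult_left_mono) (simp_all add: step_def)
    also have "\<dots> \<le> 2 * B + C * (\<Sum>k<K. (step k)^2)"
      using K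
      by (intro min_mult_sum_le_of_descent[where E = expected_loss and s = step, OF descent bounded])
        (simp_all add: step_def)
    also have "\<dots> \<le> 2 * B + C * (1 + ln (real K))"
      using sum_inverse_sqrt_sq_le_ln[OF K] \<open>0 \<le> C\<close> by (simp add: step_def mult_left_mono)
    finally show ?thesis
      using K by (simp add: pos_le_divide_eq algebra_simps)
  qed
  have "eventually (\<lambda>K. norm (Min (expected_pgrad_sq ` {..<K}))
      \<le> 1 * norm ((2 * B + C + C * ln (real K)) / sqrt (real K))) sequentially"
  proof (intro eventually_sequentiallyI[of 1])
    fix K :: nat assume K: "1 \<le> K"
    have "0 \<le> Min (expected_pgrad_sq ` {..<K})"
      using K by (intro min_expected_pgrad_sq_nonneg) simp
    thus "norm (Min (expected_pgrad_sq ` {..<K}))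
        \<le> 1 * norm ((2 * B + C + C * ln (real K)) / sqrt (real K))"
      using order_trans[OF bound[OF K] abs_ge_self] by simp
  qed
  hence "(\<lambda>K. Min (expected_pgrad_sq ` {..<K})) \<in> O(\<lambda>K. (2 * B + C + C * ln (real K)) / sqrt (real K))"
    by (rule bigoI)
  moreover have "(\<lambda>K::nat. (2 * B + C + C * ln (real K)) / sqrt (real K)) \<in> o(\<lambda>K. real K powr (\<epsilon> - 1/2))"
    using \<open>0 < \<epsilon>\<close> by real_asymp
  ultimately show ?thesis by (rule landau_o.big_small_trans)
qed

end

theorem theorem4:
  fixes f :: "real^'n^'n \<Rightarrow> real"
    and ft :: "'w \<Rightarrow> real^'n^'n \<Rightarrow> real"
    and D :: "'w measure"
    and L :: nat and V0 :: "nat \<Rightarrow> real^'n" and M1 M2 :: real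
  assumes f_diff: "\<forall>X. f differentiable (at X)"
    and M1_pos: "M1 > 0"
    and f_lip: "\<forall>X1 X2. orthogonal_matrix X1 \<longrightarrow> orthogonal_matrix X2 \<longrightarrow>
                 norm (grad f X1 - grad f X2) \<le> M1 * norm (X1 - X2)"
    and D_prob: "prob_space D"
    and ft_diff: "\<forall>\<omega>\<in>space D. \<forall>X. ft \<omega> differentiable (at X)"
    and ft_meas: "(\<lambda>(\<omega>, X). grad (ft \<omega>) X) \<in> borel_measurable (D \<Otimes>\<^sub>M borel)"
    and unbiased: "\<forall>X. orthogonal_matrix X \<longrightarrow> (\<integral>\<omega>. grad (ft \<omega>) X \<partial>D) = grad f X"
    and M2_pos: "M2 > 0"
    and second_moment: "\<forall>X. orthogonal_matrix X \<longrightarrow>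
                 (\<integral>\<^sup>+\<omega>. ennreal ((norm (grad (ft \<omega>) X))^2) \<partial>D) \<le> ennreal M2"
    and V0_nz: "\<forall>l\<in>{1..L}. V0 l \<noteq> 0"
  shows "(\<forall>\<omega>\<in>space (PiM UNIV (\<lambda>_::nat. D)). \<forall>k. \<forall>l\<in>{1..L}. sgd_iter ft L V0 \<omega> k l \<noteq> 0)
       \<and> (\<forall>\<epsilon>>0. (\<lambda>K::nat. Min {(\<Sum>l=1..L. \<integral>\<omega>. (norm (pgrad f L (sgd_iter ft L V0 \<omega> k) l))^2
                                          \<partial>(PiM UNIV (\<lambda>_::nat. D))) | k. k < K})
                 \<in> o(\<lambda>K. real K powr (\<epsilon> - 1/2)))"
proof -
  interpret householder_sgd f ft D L V0 M1 M2
    by (rule householder_sgd.intro) fact+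
  have "{(\<Sum>l=1..L. \<integral>\<omega>. (norm (pgrad f L (sgd_iter ft L V0 \<omega> k) l))^2 \<partial>\<mu>) | k. k < K}
      = expected_pgrad_sq ` {..<K}" for K
    by (auto simp: expected_pgrad_sq_def)
  thus ?thesis using iter_nz min_expected_pgrad_sq_little_o by simp
qed

end
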